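(* Consider $N$ agents with linear dynamics $\dot x_i=A_ix_i+B_iu_i$, $y_i=C_ix_i$ ($i=1,\dots,N$), satisfying assumptions (A1)–(A4) of the context, and let $y^*=(y_1^*,\dots,y_N^* )\in\mathcal Y$ be the optimal solution of the problem of minimizing $\int_0^T f(t,y)\,dt$ over $y\in\mathcal Y$ subject to $\sum_{i=1}^N g_i(t,y_i)\le \mathbf 0$ for all $t\in[0,T]$. Let every agent apply the continuous-communication controller $$u_i=-K_{\alpha_i}x_i+K_{\beta_i}\,\Pi_{\mathcal Y_i}\big[y_i,-\varepsilon \mathcal H_i^{y_i}(t,y_i,\mu_i)\big],\qquad \dot\mu_i=\Pi_{\mathbb R_+^q}\big[\mu_i,\varepsilon \mathcal H_i^{\mu_i}(t,y_i,\mu_i)\big],\qquad \mu_i(0)=\mathbf 0,$$ where $\mathcal H_i^{y_i}$, $\mathcal H_i^{\mu_i}$, $K_{\alpha_i}$, $K_{\beta_i}$ are defined in the context. Then for any $T\ge 0$ and any $\varepsilon>0$, by choosing $K_\mu\ge NK_g$, the resulting output trajectory $y(t)=\mathrm{col}(y_1(t),\dots,y_N(t))$ satisfies $$\mathcal R^T:=\int_0^T\big(f(t,y(t))-f(t,y^* )\big)\,dt\ \le\ \frac{\|y(0)-y^*\|^2}{2\varepsilon}.$$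
   Context: Agent $i$ has state $x_i\in\mathbb R^{n_i}$, input $u_i\in\mathbb R^{m_i}$, output $y_i\in\mathbb R^{p_i}$, with real matrices $A_i,B_i,C_i$ of compatible sizes; an output set $\mathcal Y_i\subseteq\mathbb R^{p_i}$ such that $y_i\in\mathcal Y_i$; a cost function $f_i(t,\cdot):\mathbb R^{p_i}\to\mathbb R$; and a constraint function $g_i(t,\cdot):\mathbb R^{p_i}\to\mathbb R^q$ with components $g_{i,1},\dots,g_{i,q}$. Write $\mathcal Y=\mathcal Y_1\times\cdots\times\mathcal Y_N$, $y=\mathrm{col}(y_1,\dots,y_N)$ (stacked vector), $f(t,y)=\sum_{i=1}^N f_i(t,y_i)$. The norm $\|\cdot\|$ is Euclidean and $\|\cdot\|_1$ is the 1-norm; vector inequalities are componentwise; $\mathbb R^q_+$ is the nonnegative orthant. Assumptions. (A1) The communication graph on $\{1,\dots,N\}$ is undirected and connected; $a_{ij}=a_{ji}=1$ if $\{i,j\}$ is an edge and $a_{ij}=0$ otherwise. (A2) Each $\mathcal Y_i$ is convex and compact; for $t\in[0,T]$, the functions $f_i(t,y_i)$ and (componentwise) $g_i(t,y_i)$ are convex, integrable and bounded on $\mathcal Y_i$, i.e. there are constants $K_f,K_g>0$ with $|f_i(t,y_i)|\le K_f$ and $\|g_i(t,y_i)\|\le K_g$. (A3) The set $\{y\in\mathcal Y:\ \sum_{i=1}^N g_i(t,y_i)\le \mathbf 0,\ t\in[0,T]\}$ is nonempty. (A4) $(A_i,B_i)$ is controllable and $\mathrm{rank}(C_iB_i)=p_i$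 for each $i$. Feedback matrices: $K_{\alpha_i},K_{\beta_i}$ are solutions of $C_iB_iK_{\alpha_i}=C_iA_i$ and $C_iB_iK_{\beta_i}=I_{p_i}$ (solutions exist by (A4)). Projection: for a closed convex set $\mathcal S\subseteq\mathbb R^n$, $x\in\mathcal S$, $v\in\mathbb R^n$, $\Pi_{\mathcal S}[x,v]=\lim_{\xi\to0^+}\frac{P_{\mathcal S}(x+\xi v)-x}{\xi}$, where $P_{\mathcal S}$ is Euclidean projection onto $\mathcal S$. Lagrangian: agent $i$ has a multiplier $\mu_i\in\mathbb R_+^q$ and, with a preset parameter $K_\mu>0$, $\mathcal H_i(t,y_i,\mu_i)=f_i(t,y_i)+\mu_i^\top g_i(t,y_i)-K_\mu\sum_{j=1}^N a_{ij}\|\mu_i-\mu_j\|_1$. $\mathcal H_i^{y_i}(t,y_i,\mu_i)$ denotes a subgradient in $y_i$: an element of $\partial f_i(t,y_i)+\sum_{k=1}^q\mu_{i,k}\,\partial g_{i,k}(t,y_i)$. $\mathcal H_i^{\mu_i}(t,y_i,\mu_i)$ denotes a subgradient in $\mu_i$ (of a concave function): an element of $g_i(t,y_i)-K_\mu\sum_{j=1}^N a_{ij}\,\mathrm{sgn}(\mu_i-\mu_j)$, where $\mathrm{sgn}$ acts componentwise and is set-valued: $\mathrm{sgn}(s)=\{-1\}$ for $s<0$, $[-1,1]$ for $s=0$, $\{1\}$ for $s>0$. Trajectories are absolutely continuous functions $(x_i,\mu_i)$ on $[0,T]$ satisfying the closed-loop equations for almost every $t$, with $y_i(t)\in\mathcal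 Y_i$ (in particular $y_i(0)\in\mathcal Y_i$) and $\mu_i(t)\in\mathbb R^q_+$.
   Formalization: The values chosen from the set-valued sgn(μ_i−μ_j) and sgn(μ_j−μ_i) are required to be opposite on each edge; with independent choices in [-1,1] where components agree, the claim fails (two scalar agents, f_i=y, g_i=-cy, both values -1). *)

theory Defs
  imports "HOL-Analysis.Analysis"
begin

text \<open>Agents are the elements of a finite type \<open>'i\<close>. Their dimensions may differ, so the state space of
  agent \<open>i\<close> is realised as a coordinate subspace of a common \<open>real ^ 'n\<close>: \<open>coord_space I\<close> is
  \<open>\<real>\<^sup>d\<close> for \<open>d = card I\<close>, and a real matrix with rows indexed by \<open>I\<close> and columns indexed by \<open>J\<close> is
  a matrix whose entries outside \<open>I \<times> J\<close> vanish. Any finite family of dimensions is obtained by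
  choosing \<open>'n\<close> large enough, and inner products, norms, topology, convexity, matrix products and ranks
  agree with those of the small spaces. A stacked vector \<open>col(y\<^sub>1,\<dots>,y\<^sub>N)\<close> is an element
  of \<open>real ^ 'p ^ 'i\<close>, whose norm is the Euclidean norm of the stacked vector.\<close>

definition coord_space :: "'n set \<Rightarrow> (real ^ 'n) set" where
  "coord_space I = {x. \<forall>k. k \<notin> I \<longrightarrow> x $ k = 0}"

definition block_matrices :: "'r set \<Rightarrow> 'c set \<Rightarrow> (real ^ 'c ^ 'r) set" where
  "block_matrices I J = {M. \<forall>r c. r \<notin> I \<or> c \<notin> J \<longrightarrow> M $ r $ c = 0}"

definition block_identity :: "'r set \<Rightarrow> real ^ 'r ^ 'r" where
  "block_identity I = (\<chi> r c. if r = c \<and> r \<in> I then 1 else 0)"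

definition abs_continuous_on :: "real \<Rightarrow> real \<Rightarrow> (real \<Rightarrow> 'a::real_normed_vector) \<Rightarrow> bool" where
  "abs_continuous_on a b x \<longleftrightarrow>
    (\<forall>e>0. \<exists>d>0. \<forall>D. finite D \<and> (\<forall>(r, s)\<in>D. a \<le> r \<and> r \<le> s \<and> s \<le> b) \<and>
      disjoint_family_on (\<lambda>(r, s). {r<..<s}) D \<and> (\<Sum>(r, s)\<in>D. s - r) < d \<longrightarrow>
      (\<Sum>(r, s)\<in>D. norm (x s - x r)) < e)"

text \<open>Every state can be steered to every other state in finite time by an integrable input.\<close>

definition controllable ::
  "'n set \<Rightarrow> 'm set \<Rightarrow> real ^ 'n ^ 'n \<Rightarrow> real ^ 'm ^ 'n \<Rightarrow> bool" where
  "controllable I J A B \<longleftrightarrow>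
    (\<forall>a\<in>coord_space I. \<forall>b\<in>coord_space I. \<exists>\<tau>>0. \<exists>x u.
      (\<forall>t\<in>{0..\<tau>}. x t \<in> coord_space I \<and> u t \<in> coord_space J) \<and>
      abs_continuous_on 0 \<tau> x \<and> u absolutely_integrable_on {0..\<tau>} \<and>
      (AE t in lebesgue_on {0..\<tau>}.
         (x has_vector_derivative A *v x t + B *v u t) (at t within {0..\<tau>})) \<and>
      x 0 = a \<and> x \<tau> = b)"

text \<open>Graphs are given by their set of edges \<open>{i, j}\<close>.\<close>

definition undirected_connected :: "'i set set \<Rightarrow> bool" where
  "undirected_connected E \<longleftrightarrow>
    (\<forall>e\<in>E. card e = 2) \<and> (\<forall>i j. (i, j) \<in> {(v, w). {v, w} \<in> E}\<^sup>*)"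

definition adjacency :: "'i set set \<Rightarrow> 'i \<Rightarrow> 'i \<Rightarrow> real" where
  "adjacency E i j = (if {i, j} \<in> E then 1 else 0)"

definition total_cost ::
  "('i::finite \<Rightarrow> real \<Rightarrow> real ^ 'p \<Rightarrow> real) \<Rightarrow> real \<Rightarrow> real ^ 'p ^ 'i \<Rightarrow> real" where
  "total_cost f t y = (\<Sum>i\<in>UNIV. f i t (y $ i))"

text \<open>The order on \<open>real ^ 'q\<close> is componentwise.\<close>

definition feasible_set ::
  "real \<Rightarrow> ('i::finite \<Rightarrow> (real ^ 'p) set) \<Rightarrow> ('i \<Rightarrow> real \<Rightarrow> real ^ 'p \<Rightarrow> real ^ 'q) \<Rightarrow>
   (real ^ 'p ^ 'i) set" where
  "feasible_set T Y g =
    {y. (\<forall>i. y $ i \<in> Y i) \<and> (\<forall>t\<in>{0..T}. (\<Sum>i\<in>UNIV. g i t (y $ i)) \<le> 0)}"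

definition optimal_solution ::
  "real \<Rightarrow> ('i::finite \<Rightarrow> (real ^ 'p) set) \<Rightarrow> ('i \<Rightarrow> real \<Rightarrow> real ^ 'p \<Rightarrow> real) \<Rightarrow>
   ('i \<Rightarrow> real \<Rightarrow> real ^ 'p \<Rightarrow> real ^ 'q) \<Rightarrow> real ^ 'p ^ 'i \<Rightarrow> bool" where
  "optimal_solution T Y f g =
    is_arg_min (\<lambda>y. integral {0..T} (\<lambda>t. total_cost f t y)) (\<lambda>y. y \<in> feasible_set T Y g)"

definition proj_direction :: "'a::euclidean_space set \<Rightarrow> 'a \<Rightarrow> 'a \<Rightarrow> 'a" where
  "proj_direction S x v =
    Lim (at_right 0) (\<lambda>\<xi>::real. (closest_point S (x + \<xi> *\<^sub>R v) - x) /\<^sub>R \<xi>)"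

definition nonneg_orthant :: "(real ^ 'q) set" where
  "nonneg_orthant = {v. 0 \<le> v}"

text \<open>Subgradients (in the ambient space \<open>V\<close>) of a function that is only assumed convex on \<open>S\<close>; the
  subgradient inequality is therefore required on \<open>S\<close>. A subgradient on all of \<open>V\<close> is in particular one in
  this sense.\<close>

definition subdifferential ::
  "'a::real_inner set \<Rightarrow> 'a set \<Rightarrow> ('a \<Rightarrow> real) \<Rightarrow> 'a \<Rightarrow> 'a set" where
  "subdifferential V S h x = {s \<in> V. \<forall>z\<in>S. h x + s \<bullet> (z - x) \<le> h z}"

definition lagrangian_subgradients_y ::
  "(real ^ 'p) set \<Rightarrow> (real ^ 'p) set \<Rightarrow> (real ^ 'p \<Rightarrow> real) \<Rightarrow> (real ^ 'p \<Rightarrow> real ^ 'q) \<Rightarrow>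
   real ^ 'p \<Rightarrow> real ^ 'q \<Rightarrow> (real ^ 'p) set" where
  "lagrangian_subgradients_y V S f g y \<mu> =
    {a + (\<Sum>k\<in>UNIV. (\<mu> $ k) *\<^sub>R b k) | a b.
       a \<in> subdifferential V S f y \<and>
       (\<forall>k. b k \<in> subdifferential V S (\<lambda>z. g z $ k) y)}"

definition sgn_set :: "real \<Rightarrow> real set" where
  "sgn_set s = (if s < 0 then {-1} else if s = 0 then {-1..1} else {1})"

text \<open>The stacked multiplier subgradients, with entries in
  \<open>g\<^sub>i - K \<Sum>\<^sub>j a\<^sub>i\<^sub>j sgn(\<mu>\<^sub>i - \<mu>\<^sub>j)\<close>. Each edge carries a single value
  \<open>\<sigma> i j\<close> of \<open>sgn(\<mu>\<^sub>i - \<mu>\<^sub>j)\<close>, and its reversal carries the opposite value of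
  \<open>sgn(\<mu>\<^sub>j - \<mu>\<^sub>i)\<close>. The oddness of sgn gives this when \<open>\<mu>\<^sub>i\<close> and \<open>\<mu>\<^sub>j\<close> differ in a
  component; where they agree it has to be part of the set-valued reading, because two unrelated
  values in \<open>[-1, 1]\<close> could make both multipliers grow at an arbitrary common rate of order \<open>K\<close>. Limits
  of the stacked vector field at points where all components differ have this property, hence so do Filippov
  solutions.\<close>

definition multiplier_subgradients ::
  "('i::finite \<Rightarrow> 'i \<Rightarrow> real) \<Rightarrow> real \<Rightarrow> ('i \<Rightarrow> real ^ 'q) \<Rightarrow> real ^ 'q ^ 'i \<Rightarrow>
   (real ^ 'q ^ 'i) set" where
  "multiplier_subgradients a K G \<mu> =
    {h. \<exists>\<sigma>. (\<forall>i j k. \<sigma> i j $ k \<in> sgn_set (\<mu> $ i $ k - \<mu> $ j $ k)) \<and>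
       (\<forall>i j. \<sigma> j i = - \<sigma> i j) \<and>
       (\<forall>i. h $ i = G i - K *\<^sub>R (\<Sum>j\<in>UNIV. a i j *\<^sub>R \<sigma> i j))}"

end

theory Submission
  imports Defs
begin

text \<open>The gain equations cancel the drift, so the outputs obey the projected subgradient flow. Along it the
  energy \<open>\<parallel>y - y\<^sup>*\<parallel>\<^sup>2 + \<parallel>\<mu>\<parallel>\<^sup>2\<close> decreases at rate at least \<open>2 \<epsilon>\<close> times the instantaneous regret:
  projections can only be dropped in the favourable direction, the subgradient inequalities leave the
  term \<open>\<Sum>\<^sub>i \<mu>\<^sub>i \<bullet> g\<^sub>i(t, y\<^sub>i\<^sup>*)\<close>, and this is absorbed by the consensus penalty, since by connectedness every
  \<open>\<mu>\<^sub>i\<close> is within the total edge variation of a common value at which the summed constraint is nonpositive.\<close>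

text \<open>Three technical points shape the proof. The projected direction is defined through
  \<open>Lim\<close>, so its existence as a limit has to be established before any inequality can be
  carried over to it. The trajectories are only absolutely continuous and the selections
  \<open>Hy\<close> and \<open>H\<mu>\<close> carry no measurability hypothesis, so the energy
  derivative is never integrated: it is bounded almost everywhere by an integrable function, and a
  one-sided fundamental theorem turns this into a bound on the increment. The costs are merely
  convex and bounded, so integrability of the regret along the trajectory has to be proved as well.
  The threshold N \<open>K\<^sub>g\<close> arises in each multiplier component separately: N agents
  deviate from a reference multiplier by at most the total edge variation, and each deviation meets
  a constraint value of size at most \<open>K\<^sub>g\<close>.\<close>

subsection \<open>The projected direction\<close>

text \<open>The limit defining the projected direction exists because the difference quotients are the
  projections of \<open>v\<close> onto the sets \<open>(S - x) / \<xi>\<close>, which increase as \<open>\<xi>\<close> decreases; it is the projection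
  of \<open>v\<close> onto the tangent cone.\<close>

lemma proj_direction_tendsto:
  fixes S :: "'a::euclidean_space set"
  assumes S: "closed S" "convex S" and x: "x \<in> S"
  shows "((\<lambda>\<xi>::real. (closest_point S (x + \<xi> *\<^sub>R v) - x) /\<^sub>R \<xi>) \<longlongrightarrow> proj_direction S x v) (at_right 0)"
proof -
  define d where "d = (\<lambda>\<xi>::real. (closest_point S (x + \<xi> *\<^sub>R v) - x) /\<^sub>R \<xi>)"
  define cone where "cone = {w. \<exists>\<xi>>0. x + \<xi> *\<^sub>R w \<in> S}"
  define p where "p = closest_point (closure cone) v"
  have shrink: "x + \<xi>' *\<^sub>R w \<in> S" if "x + \<xi> *\<^sub>R w \<in> S" "0 < \<xi>'" "\<xi>' \<le> \<xi>" for w \<xi> \<xi>'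
  proof -
    have "(1 - \<xi>' / \<xi>) *\<^sub>R x + (\<xi>' / \<xi>) *\<^sub>R (x + \<xi> *\<^sub>R w) \<in> S"
      using that by (intro convexD_alt[OF S(2) x]) auto
    then show ?thesis
      using that by (simp add: algebra_simps)
  qed
  have "convex cone"
  proof (rule convexI)
    fix w w' and a b :: real
    assume "w \<in> cone" "w' \<in> cone" and ab: "0 \<le> a" "0 \<le> b" "a + b = 1"
    then obtain \<xi> \<xi>' where \<xi>: "\<xi> > 0" "x + \<xi> *\<^sub>R w \<in> S" "\<xi>' > 0" "x + \<xi>' *\<^sub>R w' \<in> S"
      unfolding cone_def by auto
    define m where "m = min \<xi> \<xi>'"
    have "x + m *\<^sub>R w \<in> S" "x + m *\<^sub>R w' \<in> S" "m > 0"
      using \<xi> shrink unfolding m_def by auto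
    with ab have "a *\<^sub>R (x + m *\<^sub>R w) + b *\<^sub>R (x + m *\<^sub>R w') \<in> S"
      by (intro convexD[OF S(2)])
    also have "a *\<^sub>R (x + m *\<^sub>R w) + b *\<^sub>R (x + m *\<^sub>R w') = (a + b) *\<^sub>R x + m *\<^sub>R (a *\<^sub>R w + b *\<^sub>R w')"
      by (simp add: algebra_simps)
    finally show "a *\<^sub>R w + b *\<^sub>R w' \<in> cone"
      using ab \<open>m > 0\<close> unfolding cone_def by auto
  qed
  have "0 \<in> cone"
    using x unfolding cone_def by (auto intro!: exI[of _ 1])
  then have p: "p \<in> closure cone"
    unfolding p_def using closure_subset by (intro closest_point_in_set) auto
  have "(d \<longlongrightarrow> p) (at_right 0)"
  proof (rule tendstoI)
    fix r :: real
    assume "r > 0"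
    \<comment> \<open>The slack r^2 is what the final estimate consumes: the obtuse angle at p gives
      |d - p|^2 <= |v - d|^2 - |v - p|^2, and d is no farther from v than w. Taking w from the cone
      rather than from its closure makes it admissible for some positive step, hence by
      \<open>shrink\<close> for all smaller ones.\<close>
    define U where "U = {w. (norm (v - w))\<^sup>2 < (norm (v - p))\<^sup>2 + r\<^sup>2}"
    have "open U"
      unfolding U_def by (intro open_Collect_less continuous_intros)
    moreover have "p \<in> U"
      using \<open>r > 0\<close> by (simp add: U_def)
    ultimately have "U \<inter> cone \<noteq> {}"
      using p open_Int_closure_eq_empty[of U cone] by auto
    then obtain w where "w \<in> cone" and wp: "(norm (v - w))\<^sup>2 < (norm (v - p))\<^sup>2 + r\<^sup>2"
      by (auto simp: U_def)
    then obtain \<xi>\<^sub>0 where \<xi>\<^sub>0: "\<xi>\<^sub>0 > 0" "x + \<xi>\<^sub>0 *\<^sub>R w \<in> S"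
      unfolding cone_def by auto
    have "dist (d \<xi>) p < r" if \<xi>: "0 < \<xi>" "\<xi> < \<xi>\<^sub>0" for \<xi>
    proof -
      have cp: "closest_point S (x + \<xi> *\<^sub>R v) = x + \<xi> *\<^sub>R d \<xi>"
        using \<xi> by (simp add: d_def)
      then have "x + \<xi> *\<^sub>R d \<xi> \<in> S"
        using closest_point_in_set[OF S(1)] x by (metis empty_iff)
      then have "d \<xi> \<in> cone"
        using \<xi> unfolding cone_def by auto
      then have "d \<xi> \<in> closure cone"
        using closure_subset by (rule rev_subsetD)
      then have *: "(v - p) \<bullet> (d \<xi> - p) \<le> 0"
        unfolding p_def by (intro closest_point_dot convex_closure \<open>convex cone\<close>) auto
      have "dist (x + \<xi> *\<^sub>R v) (x + \<xi> *\<^sub>R d \<xi>) \<le> dist (x + \<xi> *\<^sub>R v) (x + \<xi> *\<^sub>R w)"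
        unfolding cp[symmetric] using \<xi> by (intro closest_point_le S(1) shrink[OF \<xi>\<^sub>0(2)]) auto
      then have "norm (v - d \<xi>) \<le> norm (v - w)"
        using \<xi> by (simp add: dist_norm flip: scaleR_diff_right)
      then have "(norm (v - d \<xi>))\<^sup>2 \<le> (norm (v - w))\<^sup>2"
        by (intro power_mono) auto
      moreover have "(norm (v - d \<xi>))\<^sup>2 = (norm (v - p))\<^sup>2 + (norm (d \<xi> - p))\<^sup>2 - 2 * ((v - p) \<bullet> (d \<xi> - p))"
        by (simp add: power2_norm_eq_inner inner_diff inner_commute algebra_simps)
      ultimately have "(norm (d \<xi> - p))\<^sup>2 < r\<^sup>2"
        using wp * by linarith
      then show ?thesis
        using \<open>r > 0\<close> by (simp add: dist_norm power2_less_imp_less)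
    qed
    with \<xi>\<^sub>0 show "\<forall>\<^sub>F \<xi> in at_right 0. dist (d \<xi>) p < r"
      unfolding eventually_at_right_field by (intro exI[of _ \<xi>\<^sub>0]) auto
  qed
  moreover from this have "proj_direction S x v = p"
    unfolding proj_direction_def d_def by (intro tendsto_Lim) simp
  ultimately show ?thesis
    unfolding d_def by simp
qed

text \<open>What the projection removes from v is an outward normal to S at x. The variational
  inequality for the projection of x + \<xi> v, divided by \<xi>, says this up to a term \<xi> d,
  which vanishes in the limit because the quotients d converge.\<close>

lemma proj_direction_normal:
  fixes S :: "'a::euclidean_space set"
  assumes S: "closed S" "convex S" "x \<in> S" and z: "z \<in> S"
  shows "proj_direction S x v \<bullet> (x - z) \<le> v \<bullet> (x - z)"
proof -
  define d where "d = (\<lambda>\<xi>::real. (closest_point S (x + \<xi> *\<^sub>R v) - x) /\<^sub>R \<xi>)"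
  have d: "(d \<longlongrightarrow> proj_direction S x v) (at_right 0)"
    unfolding d_def by (rule proj_direction_tendsto[OF S])
  have "\<forall>\<^sub>F \<xi> in at_right 0. (v - d \<xi>) \<bullet> (z - x - \<xi> *\<^sub>R d \<xi>) \<le> 0"
    using eventually_at_right_less
  proof eventually_elim
    case (elim \<xi>)
    have cp: "closest_point S (x + \<xi> *\<^sub>R v) = x + \<xi> *\<^sub>R d \<xi>"
      using elim by (simp add: d_def)
    have "(x + \<xi> *\<^sub>R v - (x + \<xi> *\<^sub>R d \<xi>)) \<bullet> (z - (x + \<xi> *\<^sub>R d \<xi>)) \<le> 0"
      using closest_point_dot[OF S(2,1) z] unfolding cp[symmetric] .
    then have "\<xi> * ((v - d \<xi>) \<bullet> (z - x - \<xi> *\<^sub>R d \<xi>)) \<le> 0"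
      by (simp add: inner_diff algebra_simps inner_add)
    then show ?case
      using elim by (simp add: mult_le_0_iff)
  qed
  moreover have "((\<lambda>\<xi>. (v - d \<xi>) \<bullet> (z - x - \<xi> *\<^sub>R d \<xi>)) \<longlongrightarrow>
      (v - proj_direction S x v) \<bullet> (z - x - 0 *\<^sub>R proj_direction S x v)) (at_right 0)"
    by (intro tendsto_intros d)
  ultimately have "(v - proj_direction S x v) \<bullet> (z - x - 0 *\<^sub>R proj_direction S x v) \<le> 0"
    by (intro tendsto_upperbound) auto
  then show ?thesis
    by (simp add: inner_diff)
qed

text \<open>Subspaces are closed and contain all the difference quotients. This is needed because
  \<open>block_identity\<close> acts as the identity only on its coordinate subspace.\<close>

lemma proj_direction_in_subspace:
  fixes S :: "'a::euclidean_space set"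
  assumes S: "closed S" "convex S" "x \<in> S" and V: "subspace V" "S \<subseteq> V"
  shows "proj_direction S x v \<in> V"
proof (rule Lim_in_closed_set[OF closed_subspace[OF V(1)] _ _ proj_direction_tendsto[OF S]])
  have "closest_point S w \<in> V" for w
    using closest_point_in_set[OF S(1)] S(3) V(2) by (metis empty_iff subsetD)
  then show "\<forall>\<^sub>F \<xi> in at_right 0. (closest_point S (x + \<xi> *\<^sub>R v) - x) /\<^sub>R \<xi> \<in> V"
    using S V by (intro always_eventually allI subspace_scale subspace_diff) auto
qed auto

subsection \<open>Absolutely continuous functions\<close>

lemma abs_continuous_onE:
  assumes "abs_continuous_on a b X" "e > 0"
  obtains d where "d > 0"
    "\<And>D. finite D \<Longrightarrow> \<forall>(r, s)\<in>D. a \<le> r \<and> r \<le> s \<and> s \<le> b \<Longrightarrow>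
      disjoint_family_on (\<lambda>(r, s). {r<..<s}) D \<Longrightarrow> (\<Sum>(r, s)\<in>D. s - r) < d \<Longrightarrow>
      (\<Sum>(r, s)\<in>D. norm (X s - X r)) < e"
  using assms(1)[unfolded abs_continuous_on_def, rule_format, OF assms(2)] by auto

lemma abs_continuous_on_uniform:
  assumes "abs_continuous_on a b G" "e > 0"
  obtains d where "d > 0"
    "\<And>r s. a \<le> r \<Longrightarrow> r \<le> s \<Longrightarrow> s \<le> b \<Longrightarrow> s - r < d \<Longrightarrow> norm (G s - G r) < e"
proof -
  obtain d where "d > 0" and d: "\<And>D. finite D \<Longrightarrow> (\<forall>(r, s)\<in>D. a \<le> r \<and> r \<le> s \<and> s \<le> b) \<Longrightarrow>
      disjoint_family_on (\<lambda>(r, s). {r<..<s}) D \<Longrightarrow> (\<Sum>(r, s)\<in>D. s - r) < d \<Longrightarrow>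
      (\<Sum>(r, s)\<in>D. norm (G s - G r)) < e"
    using abs_continuous_onE[OF assms] by blast
  show thesis
  proof (rule that[OF \<open>d > 0\<close>])
    fix r s assume "a \<le> r" "r \<le> s" "s \<le> b" "s - r < d"
    then show "norm (G s - G r) < e"
      using d[of "{(r, s)}"] by (auto simp: disjoint_family_on_def)
  qed
qed

lemma abs_continuous_on_imp_continuous_on:
  assumes "abs_continuous_on a b G"
  shows "continuous_on {a..b} G"
  unfolding continuous_on_iff
proof (intro ballI allI impI)
  fix t e :: real
  assume t: "t \<in> {a..b}" and "e > 0"
  then obtain d where d: "d > 0"
    "\<And>r s. a \<le> r \<Longrightarrow> r \<le> s \<Longrightarrow> s \<le> b \<Longrightarrow> s - r < d \<Longrightarrow> norm (G s - G r) < e"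
    using abs_continuous_on_uniform[OF assms] by metis
  have "dist (G s) (G t) < e" if "s \<in> {a..b}" "dist s t < d" for s
    using d(2)[of s t] d(2)[of t s] t that
    by (cases "s \<le> t") (auto simp: dist_norm norm_minus_commute)
  then show "\<exists>d>0. \<forall>s\<in>{a..b}. dist s t < d \<longrightarrow> dist (G s) (G t) < e"
    using \<open>d > 0\<close> by blast
qed

text \<open>Serves for Lipschitz images: the output as a linear image of the state, and the squared
  norm on a bounded range.\<close>

lemma abs_continuous_on_dominated:
  assumes X: "abs_continuous_on a b X"
    and G: "\<And>r s. r \<in> {a..b} \<Longrightarrow> s \<in> {a..b} \<Longrightarrow> norm (G s - G r) \<le> L * norm (X s - X r)"
  shows "abs_continuous_on a b G"
  unfolding abs_continuous_on_def
proof (intro allI impI)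
  fix e :: real
  assume "e > 0"
  \<comment> \<open>L may be zero or negative, whereas e is going to be divided by the
    constant.\<close>
  define M where "M = max L 1"
  have M: "M > 0" "L \<le> M"
    by (auto simp: M_def)
  then have e: "e / M > 0"
    using \<open>e > 0\<close> by simp
  then obtain d where "d > 0" and d: "\<And>D. finite D \<Longrightarrow> (\<forall>(r, s)\<in>D. a \<le> r \<and> r \<le> s \<and> s \<le> b) \<Longrightarrow>
      disjoint_family_on (\<lambda>(r, s). {r<..<s}) D \<Longrightarrow> (\<Sum>(r, s)\<in>D. s - r) < d \<Longrightarrow>
      (\<Sum>(r, s)\<in>D. norm (X s - X r)) < e / M"
    using abs_continuous_onE[OF X e] by blast
  show "\<exists>d>0. \<forall>D. finite D \<and> (\<forall>(r, s)\<in>D. a \<le> r \<and> r \<le> s \<and> s \<le> b) \<and>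
      disjoint_family_on (\<lambda>(r, s). {r<..<s}) D \<and> (\<Sum>(r, s)\<in>D. s - r) < d \<longrightarrow>
      (\<Sum>(r, s)\<in>D. norm (G s - G r)) < e"
  proof (intro exI[of _ d] conjI \<open>d > 0\<close> allI impI)
    fix D :: "(real \<times> real) set"
    assume D: "finite D \<and> (\<forall>(r, s)\<in>D. a \<le> r \<and> r \<le> s \<and> s \<le> b) \<and>
      disjoint_family_on (\<lambda>(r, s). {r<..<s}) D \<and> (\<Sum>(r, s)\<in>D. s - r) < d"
    have le: "norm (G s - G r) \<le> M * norm (X s - X r)" if "r \<in> {a..b}" "s \<in> {a..b}" for r s
      using G[OF that] M by (meson mult_right_mono norm_ge_zero order_trans)
    have "(\<Sum>(r, s)\<in>D. norm (G s - G r)) \<le> (\<Sum>(r, s)\<in>D. M * norm (X s - X r))"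
      using D by (intro sum_mono) (auto intro!: le)
    also have "\<dots> = M * (\<Sum>(r, s)\<in>D. norm (X s - X r))"
      by (simp add: sum_distrib_left case_prod_unfold)
    also have "\<dots> < M * (e / M)"
      using M D d[of D] by (intro mult_strict_left_mono) auto
    finally show "(\<Sum>(r, s)\<in>D. norm (G s - G r)) < e"
      using M by simp
  qed
qed

lemma abs_continuous_on_add:
  assumes X: "abs_continuous_on a b X" and Z: "abs_continuous_on a b Z"
  shows "abs_continuous_on a b (\<lambda>t. X t + Z t)"
  unfolding abs_continuous_on_def
proof (intro allI impI)
  fix e :: real
  assume "e > 0"
  then have e: "e / 2 > 0" by simp
  obtain d where "d > 0" and d: "\<And>D. finite D \<Longrightarrow> (\<forall>(r, s)\<in>D. a \<le> r \<and> r \<le> s \<and> s \<le> b) \<Longrightarrow>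
      disjoint_family_on (\<lambda>(r, s). {r<..<s}) D \<Longrightarrow> (\<Sum>(r, s)\<in>D. s - r) < d \<Longrightarrow>
      (\<Sum>(r, s)\<in>D. norm (X s - X r)) < e / 2"
      using abs_continuous_onE[OF X e] by blast
  obtain d' where "d' > 0" and d': "\<And>D. finite D \<Longrightarrow> (\<forall>(r, s)\<in>D. a \<le> r \<and> r \<le> s \<and> s \<le> b) \<Longrightarrow>
      disjoint_family_on (\<lambda>(r, s). {r<..<s}) D \<Longrightarrow> (\<Sum>(r, s)\<in>D. s - r) < d' \<Longrightarrow>
      (\<Sum>(r, s)\<in>D. norm (Z s - Z r)) < e / 2"
      using abs_continuous_onE[OF Z e] by blast
  show "\<exists>d>0. \<forall>D. finite D \<and> (\<forall>(r, s)\<in>D. a \<le> r \<and> r \<le> s \<and> s \<le> b) \<and>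
      disjoint_family_on (\<lambda>(r, s). {r<..<s}) D \<and> (\<Sum>(r, s)\<in>D. s - r) < d \<longrightarrow>
      (\<Sum>(r, s)\<in>D. norm (X s + Z s - (X r + Z r))) < e"
  proof (intro exI[of _ "min d d'"] conjI allI impI)
    fix D :: "(real \<times> real) set"
    assume D: "finite D \<and> (\<forall>(r, s)\<in>D. a \<le> r \<and> r \<le> s \<and> s \<le> b) \<and>
      disjoint_family_on (\<lambda>(r, s). {r<..<s}) D \<and> (\<Sum>(r, s)\<in>D. s - r) < min d d'"
    have "norm (X s + Z s - (X r + Z r)) \<le> norm (X s - X r) + norm (Z s - Z r)" for r s
      using norm_triangle_ineq[of "X s - X r" "Z s - Z r"] by (simp add: algebra_simps)
    then have "(\<Sum>(r, s)\<in>D. norm (X s + Z s - (X r + Z r)))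
        \<le> (\<Sum>(r, s)\<in>D. norm (X s - X r)) + (\<Sum>(r, s)\<in>D. norm (Z s - Z r))"
      unfolding sum.distrib[symmetric] by (intro sum_mono) auto
    then show "(\<Sum>(r, s)\<in>D. norm (X s + Z s - (X r + Z r))) < e"
      using D d[of D] d'[of D] by auto
  qed (use \<open>d > 0\<close> \<open>d' > 0\<close> in auto)
qed

text \<open>The square is Lipschitz on bounded sets, and the trajectory is bounded as the continuous
  image of a compact interval.\<close>

lemma abs_continuous_on_norm_square:
  fixes X :: "real \<Rightarrow> 'a::real_inner"
  assumes X: "abs_continuous_on a b X"
  shows "abs_continuous_on a b (\<lambda>t. (norm (X t))\<^sup>2)"
proof -
  have "bounded (X ` {a..b})"
    using abs_continuous_on_imp_continuous_on[OF X]
    by (intro compact_imp_bounded compact_continuous_image) auto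
  then obtain M where M: "\<And>t. t \<in> {a..b} \<Longrightarrow> norm (X t) \<le> M"
    unfolding bounded_iff by blast
  show ?thesis
  proof (rule abs_continuous_on_dominated[OF X])
    fix r s assume rs: "r \<in> {a..b}" "s \<in> {a..b}"
    have "norm ((norm (X s))\<^sup>2 - (norm (X r))\<^sup>2) = (norm (X s) + norm (X r)) * \<bar>norm (X s) - norm (X r)\<bar>"
      by (simp add: power2_eq_square square_diff_square_factored abs_mult)
    also have "\<dots> \<le> (M + M) * norm (X s - X r)"
      using M[OF rs(1)] M[OF rs(2)] norm_triangle_ineq3
      by (intro mult_mono) (auto intro: add_mono order_trans[OF norm_ge_zero])
    finally show "norm ((norm (X s))\<^sup>2 - (norm (X r))\<^sup>2) \<le> (M + M) * norm (X s - X r)" .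
  qed
qed

text \<open>A gauge argument that avoids differentiating the indefinite integral: cells tagged outside \<open>N\<close> are
  controlled by the derivative, and cells tagged in \<open>N\<close> lie in an open set so small that the total
  increment of \<open>G\<close> over them is below \<open>e\<close> by absolute continuity.\<close>

lemma abs_continuous_on_le_integral:
  fixes G G' \<phi> :: "real \<Rightarrow> real"
  assumes ab: "a \<le> b" and G: "abs_continuous_on a b G" and \<phi>: "\<phi> integrable_on {a..b}"
    and N: "negligible N"
    and deriv: "\<And>t. t \<in> {a..b} - N \<Longrightarrow> (G has_vector_derivative G' t) (at t within {a..b})"
    and le: "\<And>t. t \<in> {a..b} - N \<Longrightarrow> G' t \<le> \<phi> t"
  shows "G b - G a \<le> integral {a..b} \<phi>"
proof -
  \<comment> \<open>With value 0 on N, a cell tagged in N adds nothing to the Riemann sum, however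
    large \<phi> is at its tag.\<close>
  define \<psi> where "\<psi> = (\<lambda>t. if t \<in> N then 0 else \<phi> t)"
  define I where "I = integral {a..b} \<phi>"
  have \<psi>: "(\<psi> has_integral I) {a..b}"
    using has_integral_spike[OF N _ integrable_integral[OF \<phi>], of \<psi>] by (auto simp: \<psi>_def I_def)
  \<comment> \<open>The error budget: e for the Riemann sum, e for the cells tagged in N, and e
    times b - a for the derivative estimates on the other cells.\<close>
  have bound: "G b - G a \<le> I + e * (b - a + 2)" if "e > 0" for e
  proof -
    obtain d where "d > 0" and d: "\<And>D. finite D \<Longrightarrow> (\<forall>(r, s)\<in>D. a \<le> r \<and> r \<le> s \<and> s \<le> b) \<Longrightarrow>
        disjoint_family_on (\<lambda>(r, s). {r<..<s}) D \<Longrightarrow> (\<Sum>(r, s)\<in>D. s - r) < d \<Longrightarrow>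
        (\<Sum>(r, s)\<in>D. norm (G s - G r)) < e"
      using abs_continuous_onE[OF G \<open>e > 0\<close>] by blast
    obtain U where U: "open U" "N \<subseteq> U" "U - N \<in> lmeasurable" "emeasure lebesgue (U - N) < ennreal d"
      using sets_lebesgue_outer_open[OF negligible_imp_sets[OF N] \<open>d > 0\<close>] .
    have measure_U: "U \<in> lmeasurable" "measure lebesgue U < d"
    proof -
      have U_eq: "U = N \<union> (U - N)"
        using U(2) by blast
      show "U \<in> lmeasurable"
        by (subst U_eq) (intro fmeasurable.Un negligible_imp_measurable N U(3))
      have "measure lebesgue U \<le> measure lebesgue N + measure lebesgue (U - N)"
        by (subst U_eq, intro measure_Un_le) (use N U(3) negligible_imp_sets in auto)
      also have "measure lebesgue N = 0"
        using N by (rule negligible_imp_measure0)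
      also have "measure lebesgue (U - N) < d"
        using U(3,4) \<open>d > 0\<close> by (simp add: emeasure_eq_measure2 ennreal_less_iff)
      finally show "measure lebesgue U < d" by simp
    qed
    obtain \<gamma> where "gauge \<gamma>" and \<gamma>: "\<And>p. p tagged_division_of {a..b} \<Longrightarrow> \<gamma> fine p \<Longrightarrow>
        norm ((\<Sum>(x, K)\<in>p. measure lborel K *\<^sub>R \<psi> x) - I) < e"
      using \<psi> \<open>e > 0\<close> unfolding has_integral_real by metis
    have "\<forall>t\<in>{a..b} - N. \<exists>\<delta>. \<delta> > 0 \<and> (\<forall>s\<in>{a..b}. norm (s - t) < \<delta> \<longrightarrow>
        norm (G s - G t - (s - t) * G' t) \<le> e * norm (s - t))"
      using deriv \<open>e > 0\<close>
      unfolding has_vector_derivative_def has_derivative_within_alt by auto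
    from bchoice[OF this] obtain \<delta> where \<delta>': "\<forall>t\<in>{a..b} - N. \<delta> t > 0 \<and>
        (\<forall>s\<in>{a..b}. norm (s - t) < \<delta> t \<longrightarrow>
          norm (G s - G t - (s - t) * G' t) \<le> e * norm (s - t))" ..
    have \<delta>: "\<And>t. t \<in> {a..b} - N \<Longrightarrow> \<delta> t > 0"
      "\<And>t s. t \<in> {a..b} - N \<Longrightarrow> s \<in> {a..b} \<Longrightarrow> norm (s - t) < \<delta> t \<Longrightarrow>
        norm (G s - G t - (s - t) * G' t) \<le> e * norm (s - t)"
      using bspec[OF \<delta>'] by blast+
    define \<gamma>' where "\<gamma>' = (\<lambda>t. \<gamma> t \<inter>
      (if t \<in> N then U else if t \<in> {a..b} then ball t (\<delta> t) else UNIV))"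
    have "gauge \<gamma>'"
      using \<open>gauge \<gamma>\<close> U(1,2) \<delta>(1) unfolding gauge_def \<gamma>'_def by auto
    then obtain p where p: "p tagged_division_of {a..b}" "\<gamma>' fine p"
      by (rule fine_division_exists_real)
    have "\<gamma> fine p"
      using fineD[OF p(2)] by (intro fineI) (auto simp: \<gamma>'_def)
    have cell: "K = {Inf K..Sup K}" "Inf K \<le> x" "x \<le> Sup K" "a \<le> Inf K" "Sup K \<le> b"
      "interior K = {Inf K<..<Sup K}"
      if xK: "(x, K) \<in> p" for x K
    proof -
      obtain u v where K: "K = {u..v}"
        using tagged_division_ofD(4)[OF p(1) xK] by auto
      have "x \<in> K" "K \<subseteq> {a..b}"
        using tagged_division_ofD(2,3)[OF p(1) xK] by auto
      then show "K = {Inf K..Sup K}" "Inf K \<le> x" "x \<le> Sup K" "a \<le> Inf K" "Sup K \<le> b"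
        "interior K = {Inf K<..<Sup K}"
        by (auto simp: K)
    qed
    define q where "q = {(x, K) \<in> p. x \<in> N}"
    define ends where "ends = (\<lambda>(x::real, K::real set). (Inf K, Sup K))"
    have "finite p" "q \<subseteq> p"
      using p(1) by (auto simp: q_def)
    then have "finite q"
      using finite_subset by blast
    have overlap: "{Inf K<..<Sup K} \<inter> {Inf K'<..<Sup K'} = {}"
      if "(x, K) \<in> p" "(x', K') \<in> p" "(x, K) \<noteq> (x', K')" for x K x' K'
    proof -
      have "interior K \<inter> interior K' = {}"
        using tagged_division_ofD(5)[OF p(1) that] .
      then show ?thesis
        unfolding cell(6)[OF that(1)] cell(6)[OF that(2)] .
    qed
    have ends: "\<exists>x K. (x, K) \<in> p \<and> (x, K) \<in> q \<and> A = (Inf K, Sup K)" if "A \<in> ends ` q" for A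
      using that \<open>q \<subseteq> p\<close> by (auto simp: ends_def)
    \<comment> \<open>Absolute continuity speaks of sets of endpoint pairs, whereas q consists of
      tagged cells. Distinct cells with equal endpoints have disjoint interiors, so they are
      degenerate and contribute zero; merging them is harmless.\<close>
    have "(\<Sum>(x, K)\<in>q. norm (G (Sup K) - G (Inf K))) = (\<Sum>(r, s)\<in>ends ` q. norm (G s - G r))"
    proof (subst sum.reindex_nontrivial[OF \<open>finite q\<close>])
      fix X Y
      assume XY: "X \<in> q" "Y \<in> q" "X \<noteq> Y" "ends X = ends Y"
      obtain x K x' K' where *: "X = (x, K)" "Y = (x', K')"
        by fastforce
      have "{Inf K<..<Sup K} = {}"
        using overlap[of x K x' K'] XY \<open>q \<subseteq> p\<close> by (auto simp: * ends_def)
      moreover have "Inf K \<le> Sup K"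
        using cell(2-5)[of x K] XY \<open>q \<subseteq> p\<close> by (auto simp: *)
      ultimately have "Inf K = Sup K"
        by simp
      then show "(case ends X of (r, s) \<Rightarrow> norm (G s - G r)) = 0"
        by (simp add: * ends_def)
    qed (auto intro!: sum.cong simp: ends_def)
    also have "\<dots> < e"
    proof (rule d)
      show "finite (ends ` q)"
        using \<open>finite q\<close> by simp
      show "\<forall>(r, s)\<in>ends ` q. a \<le> r \<and> r \<le> s \<and> s \<le> b"
      proof (intro ballI)
        fix A assume "A \<in> ends ` q"
        from ends[OF this] obtain x K where "(x, K) \<in> p" "A = (Inf K, Sup K)"
          by blast
        then show "case A of (r, s) \<Rightarrow> a \<le> r \<and> r \<le> s \<and> s \<le> b"
          using cell(2-5)[of x K] by auto
      qed
      show disjoint: "disjoint_family_on (\<lambda>(r, s). {r<..<s}) (ends ` q)"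
        unfolding disjoint_family_on_def
      proof (intro ballI impI)
        fix A B assume AB: "A \<in> ends ` q" "B \<in> ends ` q" "A \<noteq> B"
        obtain x K x' K' where "(x, K) \<in> p" "A = (Inf K, Sup K)" "(x', K') \<in> p" "B = (Inf K', Sup K')"
          using ends[OF AB(1)] ends[OF AB(2)] by blast
        moreover from this have "(x, K) \<noteq> (x', K')"
          using AB(3) by auto
        ultimately  show "(case A of (r, s) \<Rightarrow> {r<..<s}) \<inter> (case B of (r, s) \<Rightarrow> {r<..<s}) = {}"
          using overlap[of x K x' K'] by simp
      qed
      \<comment> \<open>Disjointness turns the total length into the measure of a union of
        intervals, and the gauge keeps this union inside U.\<close>
      have "(\<Sum>(r, s)\<in>ends ` q. s - r) = (\<Sum>A\<in>ends ` q. measure lebesgue (case A of (r, s) \<Rightarrow> {r<..<s}))"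
      proof (intro sum.cong refl)
        fix A assume "A \<in> ends ` q"
        from ends[OF this] obtain x K where "(x, K) \<in> p" "A = (Inf K, Sup K)"
          by blast
        then show "(case A of (r, s) \<Rightarrow> s - r) = measure lebesgue (case A of (r, s) \<Rightarrow> {r<..<s})"
          using cell(2-5)[of x K] by auto
      qed
      also have "\<dots> = measure lebesgue (\<Union>A\<in>ends ` q. case A of (r, s) \<Rightarrow> {r<..<s})"
        using disjoint \<open>finite q\<close>
        by (intro measure_finite_Union[symmetric]) (auto simp: emeasure_lborel_box_eq box_real[symmetric] split: prod.splits simp del: box_real)
      also have "\<dots> \<le> measure lebesgue U"
      proof (rule measure_mono_fmeasurable[OF _ _ measure_U(1)])
        have "{Inf K<..<Sup K} \<subseteq> U" if xK: "(x, K) \<in> q" for x K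
        proof -
          have "K \<subseteq> U"
            using fineD[OF p(2), of x K] xK by (simp add: q_def \<gamma>'_def)
          moreover have "{Inf K<..<Sup K} \<subseteq> {Inf K..Sup K}"
            by auto
          then have "{Inf K<..<Sup K} \<subseteq> K"
            using cell(1)[of x K] xK \<open>q \<subseteq> p\<close> by auto
          ultimately show ?thesis by blast
        qed
        then show "(\<Union>A\<in>ends ` q. case A of (r, s) \<Rightarrow> {r<..<s}) \<subseteq> U"
          unfolding ends_def UN_subset_iff by auto
        show "(\<Union>A\<in>ends ` q. case A of (r, s) \<Rightarrow> {r<..<s}) \<in> sets lebesgue"
          using \<open>finite q\<close> by (intro sets.finite_UN) (auto split: prod.splits)
      qed
      also have "\<dots> < d"
        by (rule measure_U(2))
      finally show "(\<Sum>(r, s)\<in>ends ` q. s - r) < d" .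
    qed
    finally have exceptional: "(\<Sum>(x, K)\<in>q. norm (G (Sup K) - G (Inf K))) < e" .

    have cell_bound: "G (Sup K) - G (Inf K) \<le> measure lborel K *\<^sub>R \<psi> x + e * measure lborel K +
        (if x \<in> N then norm (G (Sup K) - G (Inf K)) else 0)" if xK: "(x, K) \<in> p" for x K
    proof (cases "x \<in> N")
      case True
      then show ?thesis
        using \<open>e > 0\<close> by (simp add: \<psi>_def add_increasing)
    next
      case False
      have x: "x \<in> {a..b} - N"
        using cell(2-5)[OF xK] False by auto
      have content_K: "measure lborel K = Sup K - Inf K"
      proof -
        have "measure lborel {Inf K..Sup K} = Sup K - Inf K"
          using cell(2-5)[OF xK] by (intro content_real) linarith
        then show ?thesis
          unfolding cell(1)[OF xK, symmetric] .
      qed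
      have "K \<subseteq> ball x (\<delta> x)"
        using fineD[OF p(2) xK] False x by (simp add: \<gamma>'_def)
      moreover have "Inf K \<in> {Inf K..Sup K}" "Sup K \<in> {Inf K..Sup K}"
        using cell(2-5)[OF xK] by auto
      then have "Inf K \<in> K" "Sup K \<in> K"
        unfolding cell(1)[OF xK, symmetric] .
      ultimately have "norm (Inf K - x) < \<delta> x" "norm (Sup K - x) < \<delta> x"
        by (auto simp: dist_norm norm_minus_commute)
      then have "norm (G (Inf K) - G x - (Inf K - x) * G' x) \<le> e * norm (Inf K - x)"
          "norm (G (Sup K) - G x - (Sup K - x) * G' x) \<le> e * norm (Sup K - x)"
        using cell(2-5)[OF xK] \<delta>(2)[OF x, of "Inf K"] \<delta>(2)[OF x, of "Sup K"] by simp_all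
      \<comment> \<open>The tag lies between the two endpoints, so the two errors add up to exactly
        e times the length of the cell.\<close>
      then have "G (Sup K) - G (Inf K) \<le> (Sup K - Inf K) * G' x + e * (Sup K - Inf K)"
        using cell(2-5)[OF xK] by (auto simp: abs_le_iff algebra_simps)
      also have "(Sup K - Inf K) * G' x \<le> (Sup K - Inf K) * \<psi> x"
        using cell(2-5)[OF xK] le[OF x] False by (intro mult_left_mono) (auto simp: \<psi>_def)
      finally show ?thesis
        using False by (simp add: content_K)
    qed
    have "G b - G a = (\<Sum>(x, K)\<in>p. G (Sup K) - G (Inf K))"
      using additive_tagged_division_1[OF ab p(1), of G] by simp
    also have "\<dots> \<le> (\<Sum>(x, K)\<in>p. measure lborel K *\<^sub>R \<psi> x + e * measure lborel K +
        (if x \<in> N then norm (G (Sup K) - G (Inf K)) else 0))"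
      using cell_bound by (intro sum_mono) auto
    also have "\<dots> = (\<Sum>(x, K)\<in>p. measure lborel K *\<^sub>R \<psi> x) + e * (\<Sum>(x, K)\<in>p. measure lborel K) +
        (\<Sum>(x, K)\<in>p. if x \<in> N then norm (G (Sup K) - G (Inf K)) else 0)"
      by (simp add: sum.distrib sum_distrib_left case_prod_unfold)
    also have "(\<Sum>(x, K)\<in>p. measure lborel K) = b - a"
      using additive_content_tagged_division[of p a b] p(1) ab by simp
    also have "(\<Sum>(x, K)\<in>p. if x \<in> N then norm (G (Sup K) - G (Inf K)) else 0) =
        (\<Sum>(x, K)\<in>q. norm (G (Sup K) - G (Inf K)))"
      using \<open>finite p\<close> unfolding q_def
      by (intro sum.mono_neutral_cong_right) (auto split: if_splits)
    finally show ?thesis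
      using exceptional \<gamma>[OF p(1) \<open>\<gamma> fine p\<close>] by (simp add: abs_less_iff algebra_simps)
  qed
  have "G b - G a \<le> I + e" if "e > 0" for e
  proof -
    have "G b - G a \<le> I + e / (b - a + 2) * (b - a + 2)"
      using that ab by (intro bound) auto
    then show ?thesis
      using ab by simp
  qed
  then show ?thesis
    unfolding I_def by (rule field_le_epsilon)
qed

subsection \<open>Measurability of the cost along the trajectory\<close>

text \<open>A ball around z within the affine hull of S stays in S. Prolonging the line through z
  and w to distance r on both sides of z gives points p (towards w) and p' (away from w) in S.
  Convexity along this line and the bound K then give a Lipschitz estimate at z with constant 2 K /
  r. Working in the affine hull covers sets with empty interior, such as subsets of a proper
  coordinate subspace.\<close>

lemma convex_on_bounded_continuous_rel_interior:
  fixes h :: "'a::euclidean_space \<Rightarrow> real"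
  assumes h: "convex_on S h" and K: "\<And>z. z \<in> S \<Longrightarrow> \<bar>h z\<bar> \<le> K"
  shows "continuous_on (rel_interior S) h"
  unfolding continuous_on_iff
proof (intro ballI allI impI)
  fix z and e :: real
  assume z: "z \<in> rel_interior S" and "e > 0"
  obtain r where "r > 0" "z \<in> S" and r: "cball z r \<inter> affine hull S \<subseteq> S"
    using z unfolding mem_rel_interior_cball by blast
  have "K \<ge> 0"
    using K[OF \<open>z \<in> S\<close>] by linarith
  have cancel: "k *\<^sub>R p + (- k *\<^sub>R p + 1 *\<^sub>R q) = q" "k *\<^sub>R p + (1 *\<^sub>R q + - k *\<^sub>R p) = q"
    for k and p q :: 'a
    by simp_all
  have lipschitz: "\<bar>h w - h z\<bar> \<le> dist w z / r * (2 * K)" if "w \<in> S" for w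
  proof (cases "w = z")
    case False
    define s where "s = dist w z"
    have "s > 0"
      using False by (simp add: s_def)
    have hull: "w \<in> affine hull S" "z \<in> affine hull S"
      using that \<open>z \<in> S\<close> hull_subset by fast+
    define p p' where "p = (1 - r / s) *\<^sub>R z + (r / s) *\<^sub>R w"
      and "p' = (1 - - (r / s)) *\<^sub>R z + (- (r / s)) *\<^sub>R w"
    have "p \<in> affine hull S" "p' \<in> affine hull S"
      unfolding p_def p'_def by (simp_all only: mem_affine[OF affine_affine_hull hull(2,1)] diff_add_cancel)
    moreover have "z - p = (r / s) *\<^sub>R (z - w)" "z - p' = (r / s) *\<^sub>R (w - z)"
      by (simp_all add: p_def p'_def algebra_simps)
    then have "dist z p = r" "dist z p' = r"
      using \<open>s > 0\<close> \<open>r > 0\<close> by (simp_all add: dist_norm s_def norm_minus_commute)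
    ultimately have p: "p \<in> S" "p' \<in> S"
      using r by auto
    \<comment> \<open>The point z lies between w and p', at distance s from w and r from p', whence
      the weight.\<close>
    have "h ((1 - s / (r + s)) *\<^sub>R w + (s / (r + s)) *\<^sub>R p') \<le> (1 - s / (r + s)) * h w + s / (r + s) * h p'"
      using \<open>s > 0\<close> \<open>r > 0\<close> p that by (intro convex_onD[OF h]) auto
    moreover have "(1 - s / (r + s)) *\<^sub>R w + (s / (r + s)) *\<^sub>R p' = z"
    proof -
      have pos: "r + s > 0" "s \<noteq> 0"
        using \<open>s > 0\<close> \<open>r > 0\<close> by linarith+
      have "s / (r + s) + r / (r + s) = 1"
        using pos(1) by (simp add: add.commute flip: add_divide_distrib)
      moreover have "s / (r + s) * (r / s) = r / (r + s)"
        using pos(2) by simp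
      ultimately have "s / (r + s) * (1 - - (r / s)) = 1" "s / (r + s) * - (r / s) = - (1 - s / (r + s))"
        unfolding diff_minus_eq_add distrib_left mult_minus_right by linarith+
      then show ?thesis
        unfolding p'_def scaleR_add_right scaleR_scaleR by (simp only: cancel)
    qed
    ultimately have "h z - h w \<le> s / (r + s) * (h p' - h w)"
      by (simp only: left_diff_distrib right_diff_distrib mult_1_left)
    also have "\<dots> \<le> s / (r + s) * (2 * K)"
      using \<open>s > 0\<close> \<open>r > 0\<close> K[OF p(2)] K[OF that] by (intro mult_left_mono) auto
    also have "\<dots> \<le> s / r * (2 * K)"
      using \<open>s > 0\<close> \<open>r > 0\<close> \<open>K \<ge> 0\<close> by (intro mult_right_mono frac_le) auto
    finally have upper: "h z - h w \<le> s / r * (2 * K)" .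
    have lower: "h w - h z \<le> s / r * (2 * K)"
    proof (cases "s \<le> r")
      case True
      have "h ((1 - s / r) *\<^sub>R z + (s / r) *\<^sub>R p) \<le> (1 - s / r) * h z + s / r * h p"
        using \<open>s > 0\<close> \<open>r > 0\<close> True p \<open>z \<in> S\<close> by (intro convex_onD[OF h]) auto
      moreover have "(1 - s / r) *\<^sub>R z + (s / r) *\<^sub>R p = w"
      proof -
        have "s / r * (r / s) = 1"
          using \<open>s > 0\<close> \<open>r > 0\<close> by simp
        moreover from this have "s / r * (1 - r / s) = - (1 - s / r)"
          unfolding right_diff_distrib by linarith
        ultimately show ?thesis
          unfolding p_def scaleR_add_right scaleR_scaleR by (simp only: cancel)
      qed
      ultimately have "h w - h z \<le> s / r * (h p - h z)"
        by (simp only: left_diff_distrib right_diff_distrib mult_1_left)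
      also have "\<dots> \<le> s / r * (2 * K)"
        using \<open>s > 0\<close> \<open>r > 0\<close> K[OF p(1)] K[OF \<open>z \<in> S\<close>] by (intro mult_left_mono) auto
      finally show ?thesis .
    next
      case False
      \<comment> \<open>Here w lies beyond p, where convexity gives no upper bound; but s / r
        exceeds 1, so the crude bound 2 K suffices.\<close>
      have "h w - h z \<le> 1 * (2 * K)"
        using K[OF that] K[OF \<open>z \<in> S\<close>] by auto
      also have "\<dots> \<le> s / r * (2 * K)"
        using \<open>r > 0\<close> \<open>K \<ge> 0\<close> False by (intro mult_right_mono) auto
      finally show ?thesis .
    qed
    show ?thesis
      using upper lower unfolding s_def by linarith
  qed simp
  show "\<exists>d>0. \<forall>w\<in>rel_interior S. dist w z < d \<longrightarrow> dist (h w) (h z) < e"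
  \<comment> \<open>The added 1 keeps the denominator positive when K = 0.\<close>
  proof (intro exI[of _ "e * r / (2 * K + 1)"] conjI ballI impI)
    show "e * r / (2 * K + 1) > 0"
      using \<open>e > 0\<close> \<open>r > 0\<close> \<open>K \<ge> 0\<close> by simp
    fix w assume w: "w \<in> rel_interior S" and d: "dist w z < e * r / (2 * K + 1)"
    have "w \<in> S"
      using w rel_interior_subset by fast
    then have "dist (h w) (h z) \<le> dist w z / r * (2 * K)"
      using lipschitz by (simp add: dist_norm)
    also have "\<dots> \<le> dist w z / r * (2 * K + 1)"
      using \<open>r > 0\<close> by (intro mult_left_mono) auto
    also have "\<dots> < e"
      using d \<open>r > 0\<close> \<open>K \<ge> 0\<close> by (simp add: pos_less_divide_eq pos_divide_less_eq)
    finally show "dist (h w) (h z) < e" .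
  qed
qed

text \<open>Rounding down to a grid makes the approximating times depend on an integer only.
  Clamping keeps them in the interval and, since t itself lies there, does not increase the
  error.\<close>

lemma clamped_floor_tendsto:
  fixes t :: real
  assumes "t \<in> {a..b}"
  shows "(\<lambda>n. max a (min b (of_int \<lfloor>real (Suc n) * t\<rfloor> / real (Suc n)))) \<longlonglongrightarrow> t"
proof (rule Lim_null_comparison[THEN LIM_zero_cancel])
  have "\<bar>max a (min b (of_int \<lfloor>real (Suc n) * t\<rfloor> / real (Suc n))) - t\<bar> \<le> 1 / real (Suc n)" for n
  proof -
    define q where "q = of_int \<lfloor>real (Suc n) * t\<rfloor> / real (Suc n)"
    have "q \<le> t"
      unfolding q_def by (simp add: pos_divide_le_eq mult.commute del: of_nat_Suc)
    moreover have "t \<le> q + 1 / real (Suc n)"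
      unfolding q_def add_divide_distrib[symmetric]
      using real_of_int_floor_add_one_ge[of "real (Suc n) * t"]
      by (simp add: pos_le_divide_eq mult.commute del: of_nat_Suc)
    ultimately show ?thesis
      using assms unfolding q_def[symmetric] by (auto simp: max_def min_def)
  qed
  then show "\<forall>\<^sub>F n in sequentially.
      norm (max a (min b (of_int \<lfloor>real (Suc n) * t\<rfloor> / real (Suc n))) - t) \<le> 1 / real (Suc n)"
    by simp
  show "(\<lambda>n. 1 / real (Suc n)) \<longlonglongrightarrow> 0"
    using LIMSEQ_inverse_real_of_nat by (simp add: inverse_eq_divide)
qed

text \<open>The Caratheodory argument: with the trajectory frozen at grid times, each approximation
  is pieced together from countably many measurable functions of t by a measurable integer index.
  Continuity in the second argument recovers the composition in the limit.\<close>

lemma caratheodory_compose_measurable: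
  fixes h :: "real \<Rightarrow> 'a::metric_space \<Rightarrow> real"
  assumes "a \<le> b"
    and meas: "\<And>z. z \<in> R \<Longrightarrow> (\<lambda>t. h t z) \<in> borel_measurable (lebesgue_on {a..b})"
    and cont: "\<And>t. t \<in> {a..b} \<Longrightarrow> continuous_on R (h t)"
    and w: "continuous_on {a..b} w" "\<And>t. t \<in> {a..b} \<Longrightarrow> w t \<in> R"
  shows "(\<lambda>t. h t (w t)) \<in> borel_measurable (lebesgue_on {a..b})"
proof -
  define c where "c = (\<lambda>n t. max a (min b (of_int \<lfloor>real (Suc n) * t\<rfloor> / real (Suc n))))"
  have c: "c n t \<in> {a..b}" for n t
    using \<open>a \<le> b\<close> by (auto simp: c_def)
  show ?thesis
  proof (rule borel_measurable_LIMSEQ_real)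
    fix n
    have "(\<lambda>t. real (Suc n) * t) \<in> borel_measurable (lebesgue_on {a..b})"
      by (rule continuous_imp_measurable_on_sets_lebesgue) (auto intro: continuous_intros)
    from measurable_compose[OF this measurable_real_floor]
    have "(\<lambda>t. (\<lambda>i t. h t (w (max a (min b (of_int i / real (Suc n)))))) \<lfloor>real (Suc n) * t\<rfloor> t)
        \<in> borel_measurable (lebesgue_on {a..b})"
    proof (rule measurable_compose_countable[rotated])
      fix i :: int
      have "max a (min b (of_int i / real (Suc n))) \<in> {a..b}"
        using \<open>a \<le> b\<close> by simp
      then show "(\<lambda>t. h t (w (max a (min b (of_int i / real (Suc n))))))
          \<in> borel_measurable (lebesgue_on {a..b})"
        by (intro meas w(2))
    qed
    then show "(\<lambda>t. h t (w (c n t))) \<in> borel_measurable (lebesgue_on {a..b})"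
      by (simp add: c_def)
  next
    fix t assume "t \<in> space (lebesgue_on {a..b})"
    then have t: "t \<in> {a..b}"
      by simp
    have "(\<lambda>n. w (c n t)) \<longlonglongrightarrow> w t"
      using clamped_floor_tendsto[OF t] c t
      by (intro continuous_on_tendsto_compose[OF w(1)]) (auto simp: c_def)
    then show "(\<lambda>n. h t (w (c n t))) \<longlonglongrightarrow> h t (w t)"
      using w(2) t c by (intro continuous_on_tendsto_compose[OF cont[OF t]]) auto
  qed
qed

text \<open>A convex function may be discontinuous, and arbitrary on extreme points, at the relative boundary of
  \<open>S\<close>, so measurability of \<open>h t (y t)\<close> is not automatic. The trajectory is pushed towards a point of the
  relative interior, where \<open>h t\<close> is continuous; passing to the limit, convexity gives the upper bound and
  the subgradient at \<open>y t\<close> the lower one.\<close>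

lemma convex_along_trajectory_absolutely_integrable:
  fixes h :: "real \<Rightarrow> 'a::euclidean_space \<Rightarrow> real"
  assumes convex: "\<And>t. t \<in> {a..b} \<Longrightarrow> convex_on S (h t)"
    and bound: "\<And>t z. t \<in> {a..b} \<Longrightarrow> z \<in> S \<Longrightarrow> \<bar>h t z\<bar> \<le> K"
    and integrable: "\<And>z. z \<in> S \<Longrightarrow> (\<lambda>t. h t z) absolutely_integrable_on {a..b}"
    and y: "continuous_on {a..b} y" "\<And>t. t \<in> {a..b} \<Longrightarrow> y t \<in> S"
    and N: "negligible N"
    and subgradient: "\<And>t. t \<in> {a..b} - N \<Longrightarrow> subdifferential V S (h t) (y t) \<noteq> {}"
  shows "(\<lambda>t. h t (y t)) absolutely_integrable_on {a..b}"
proof (cases "a \<le> b")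
  case True
  then have "convex S" "S \<noteq> {}"
    using convex_on_imp_convex[OF convex[of a]] y(2)[of a] by auto
  then obtain z where z: "z \<in> rel_interior S"
    using rel_interior_eq_empty by blast
  then have "z \<in> S"
    using rel_interior_subset by fast
  \<comment> \<open>Strictly positive, so that \<open>w n t\<close> lies in the relative interior
    even when \<open>y t\<close> is on the relative boundary.\<close>
  define l where "l = (\<lambda>n. 1 / real (Suc n))"
  have l: "0 < l n" "l n \<le> 1" for n
    by (auto simp: l_def)
  have l_lim: "l \<longlonglongrightarrow> 0"
    unfolding l_def using LIMSEQ_inverse_real_of_nat by (simp add: inverse_eq_divide)
  define w where "w = (\<lambda>n t. y t - l n *\<^sub>R (y t - z))"
  have w: "w n t \<in> rel_interior S" if "t \<in> {a..b}" for n t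
    unfolding w_def using rel_interior_convex_shrink[OF \<open>convex S\<close> z y(2)[OF that] l] .
  then have wS: "w n t \<in> S" if "t \<in> {a..b}" for n t
    using that rel_interior_subset by fast
  have w_eq: "w n t = (1 - l n) *\<^sub>R y t + l n *\<^sub>R z" for n t
    by (simp add: w_def algebra_simps)
  have abs_int: "(\<lambda>t. h t (w n t)) absolutely_integrable_on {a..b}" for n
  proof (rule measurable_bounded_by_integrable_imp_absolutely_integrable)
    show "(\<lambda>t. h t (w n t)) \<in> borel_measurable (lebesgue_on {a..b})"
    proof (rule caratheodory_compose_measurable[OF True, where R = "rel_interior S"])
      fix x assume "x \<in> rel_interior S"
      then have "x \<in> S"
        using rel_interior_subset by fast
      then show "(\<lambda>t. h t x) \<in> borel_measurable (lebesgue_on {a..b})"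
        by (intro absolutely_integrable_imp_borel_measurable integrable) auto
    next
      fix t assume "t \<in> {a..b}"
      then show "continuous_on (rel_interior S) (h t)"
        by (intro convex_on_bounded_continuous_rel_interior[of S "h t" K] convex bound)
    next
      show "continuous_on {a..b} (w n)"
        unfolding w_def by (intro continuous_intros y(1))
    qed (rule w)
    show "(\<lambda>t. K) integrable_on {a..b}"
      by (rule integrable_const_ivl)
    show "norm (h t (w n t)) \<le> K" if "t \<in> {a..b}" for t
      using bound[OF that wS[OF that]] by simp
  qed auto
  \<comment> \<open>Subgradients are available only off N, whereas dominated convergence asks for a
    limit at every time; hence both the sequence and its limit are set to 0 on N.\<close>
  define F where "F = (\<lambda>n t. if t \<in> N then 0 else h t (w n t))"
  define H where "H = (\<lambda>t. if t \<in> N then 0 else h t (y t))"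
  have "K \<ge> 0"
    using True bound[of a z] \<open>z \<in> S\<close> by auto
  have "H integrable_on {a..b}"
  proof (rule dominated_convergence(1))
    fix n
    have "(\<lambda>t. h t (w n t)) integrable_on {a..b}"
      using abs_int by (rule set_lebesgue_integral_eq_integral(1))
    then show "F n integrable_on {a..b}"
      by (rule integrable_spike[OF _ N]) (simp add: F_def)
  next
    show "(\<lambda>t. K) integrable_on {a..b}"
      by (rule integrable_const_ivl)
    show "norm (F n t) \<le> K" if "t \<in> {a..b}" for n t
      using bound[OF that wS[OF that]] \<open>K \<ge> 0\<close> by (simp add: F_def)
    have "(\<lambda>n. h t (w n t)) \<longlonglongrightarrow> h t (y t)" if t: "t \<in> {a..b} - N" for t
    proof -
      obtain s where s: "\<And>x. x \<in> S \<Longrightarrow> h t (y t) + s \<bullet> (x - y t) \<le> h t x"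
        using subgradient[OF t] by (auto simp: subdifferential_def)
      show ?thesis
      proof (rule tendsto_sandwich)
        show "\<forall>\<^sub>F n in sequentially. h t (y t) - l n * (s \<bullet> (y t - z)) \<le> h t (w n t)"
        proof (intro always_eventually allI)
          fix n
          have "h t (y t) + s \<bullet> (w n t - y t) \<le> h t (w n t)"
            using s wS t by simp
          also have "w n t - y t = - (l n *\<^sub>R (y t - z))"
            by (simp add: w_def)
          finally show "h t (y t) - l n * (s \<bullet> (y t - z)) \<le> h t (w n t)"
            by simp
        qed
        show "\<forall>\<^sub>F n in sequentially. h t (w n t) \<le> (1 - l n) * h t (y t) + l n * h t z"
          unfolding w_eq using t l \<open>z \<in> S\<close> y(2)
          by (intro always_eventually allI convex_onD[OF convex]) (auto simp: less_imp_le)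
        show "(\<lambda>n. h t (y t) - l n * (s \<bullet> (y t - z))) \<longlonglongrightarrow> h t (y t)"
          by (auto intro!: tendsto_eq_intros l_lim)
        show "(\<lambda>n. (1 - l n) * h t (y t) + l n * h t z) \<longlonglongrightarrow> h t (y t)"
          by (auto intro!: tendsto_eq_intros l_lim)
      qed
    qed
    then show "(\<lambda>n. F n t) \<longlonglongrightarrow> H t" if "t \<in> {a..b}" for t
      using that by (simp add: F_def H_def)
  qed
  then have "(\<lambda>t. h t (y t)) integrable_on {a..b}"
    by (rule integrable_spike[OF _ N]) (simp add: H_def)
  then show ?thesis
  proof (rule absolutely_integrable_integrable_bound[rotated])
    show "(\<lambda>t. K) integrable_on {a..b}"
      by (rule integrable_const_ivl)
    show "norm (h t (y t)) \<le> K" if "t \<in> {a..b}" for t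
      using bound[OF that y(2)[OF that]] by simp
  qed
qed simp

subsection \<open>Lagrangian estimates and the regret bound\<close>

lemma AE_lebesgue_on_negligibleE:
  assumes "AE t in lebesgue_on S. P t" "S \<in> sets lebesgue"
  obtains N where "negligible N" "\<And>t. t \<in> S - N \<Longrightarrow> P t"
proof -
  have "AE t in lebesgue. t \<in> S \<longrightarrow> P t"
    using assms by (simp add: AE_restrict_space_iff)
  then obtain N where "negligible N" "{t. \<not> (t \<in> S \<longrightarrow> P t)} \<subseteq> N"
    unfolding eventually_ae_filter_negligible by blast
  then show thesis
    by (intro that[of N]) auto
qed

text \<open>In a connected graph, the difference between two values is accumulated across edges. The
  half compensates for the double sum meeting every edge in both orientations.\<close>

lemma oscillation_le_edge_variation:
  fixes \<phi> :: "'i::finite \<Rightarrow> real"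
  assumes conn: "undirected_connected E"
  shows "\<bar>\<phi> i - \<phi> j\<bar> \<le> (\<Sum>a\<in>UNIV. \<Sum>b\<in>UNIV. adjacency E a b * \<bar>\<phi> a - \<phi> b\<bar>) / 2"
proof -
  \<comment> \<open>Growing a vertex set edge by edge charges every edge at most once, without the need for a
    simple path from \<open>i\<close> to \<open>j\<close>.\<close>
  define \<V> where "\<V> = (\<lambda>S. \<Sum>a\<in>S. \<Sum>b\<in>S. adjacency E a b * \<bar>\<phi> a - \<phi> b\<bar>)"
  define Q where "Q = (\<lambda>S. j \<in> S \<and> (\<forall>v\<in>S. \<bar>\<phi> v - \<phi> j\<bar> \<le> \<V> S / 2))"
  have adj: "adjacency E a b \<ge> 0" "adjacency E a b = adjacency E b a" for a b
    by (auto simp: adjacency_def insert_commute)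
  \<comment> \<open>The new vertex enters the double sum both as a row and as a column, hence the
    factor 2; its diagonal term vanishes.\<close>
  have \<V>_insert: "\<V> (insert w S) = \<V> S + 2 * (\<Sum>a\<in>S. adjacency E a w * \<bar>\<phi> a - \<phi> w\<bar>)"
    if "w \<notin> S" for w S
  proof -
    have "(\<Sum>b\<in>S. adjacency E w b * \<bar>\<phi> w - \<phi> b\<bar>) = (\<Sum>a\<in>S. adjacency E a w * \<bar>\<phi> a - \<phi> w\<bar>)"
      using adj(2) by (auto intro: sum.cong simp: abs_minus_commute)
    then show ?thesis
      using that by (simp add: \<V>_def sum.distrib)
  qed
  have grow: "Q (insert w S)" if "Q S" "v \<in> S" "{v, w} \<in> E" for v w S
  proof (cases "w \<in> S")
    case False
    have "adjacency E v w * \<bar>\<phi> v - \<phi> w\<bar> \<le> (\<Sum>a\<in>S. adjacency E a w * \<bar>\<phi> a - \<phi> w\<bar>)"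
      using adj(1) that by (intro member_le_sum) auto
    then have "\<bar>\<phi> v - \<phi> w\<bar> \<le> (\<Sum>a\<in>S. adjacency E a w * \<bar>\<phi> a - \<phi> w\<bar>)"
      using that by (simp add: adjacency_def)
    moreover have Q: "j \<in> S" "\<And>u. u \<in> S \<Longrightarrow> \<bar>\<phi> u - \<phi> j\<bar> \<le> \<V> S / 2"
      using that by (auto simp: Q_def)
    moreover have "\<bar>\<phi> v - \<phi> j\<bar> \<le> \<V> S / 2"
      using Q(2) that(2) .
    moreover have "\<bar>\<phi> w - \<phi> j\<bar> \<le> \<bar>\<phi> v - \<phi> w\<bar> + \<bar>\<phi> v - \<phi> j\<bar>"
      by linarith
    moreover have "0 \<le> \<bar>\<phi> v - \<phi> w\<bar>"
      by simp
    ultimately have "\<bar>\<phi> w - \<phi> j\<bar> \<le> \<V> (insert w S) / 2" "\<V> S / 2 \<le> \<V> (insert w S) / 2"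
      unfolding \<V>_insert[OF False] add_divide_distrib by auto
    then show ?thesis
      using Q unfolding Q_def by (auto intro: order_trans)
  qed (use that in \<open>simp add: insert_absorb\<close>)
  have "Q {j}"
    by (auto simp: Q_def \<V>_def)
  then have "{S. Q S} \<noteq> {}"
    by blast
  \<comment> \<open>By \<open>grow\<close>, no edge can leave a maximal set satisfying Q, so
    connectedness forces it to contain every vertex.\<close>
  then obtain S where S: "Q S" and maximal: "\<And>S'. Q S' \<Longrightarrow> S \<subseteq> S' \<Longrightarrow> S' = S"
    using finite_has_maximal[of "{S. Q S}"] finite by blast
  have "i \<in> S" for i
  proof -
    have "(j, i) \<in> {(v, w). {v, w} \<in> E}\<^sup>*"
      using conn by (simp add: undirected_connected_def)
    then show ?thesis
    proof (induction rule: rtrancl_induct)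
      case base
      then show ?case
        using S by (simp add: Q_def)
    next
      case (step v w)
      then show ?case
        using grow[OF S] maximal[of "insert w S"] by auto
    qed
  qed
  then have "S = UNIV"
    by blast
  then show ?thesis
    using S by (auto simp: Q_def \<V>_def)
qed

text \<open>Exchanging i and j, with a symmetric and \<sigma> odd, replaces \<mu>_i by -\<mu>_j in
  the double sum; averaging both forms leaves half the sum of (\<mu>_i - \<mu>_j) paired with
  \<sigma>. Since s times any element of sgn(s) is |s|, also for s = 0, the result does not depend
  on the selection.\<close>

lemma inner_multiplier_subgradient:
  fixes \<mu> h :: "real ^ 'q::finite ^ 'i::finite"
  assumes h: "h \<in> multiplier_subgradients a K G \<mu>" and sym: "\<And>i j. a i j = a j i"
  shows "\<mu> \<bullet> h = (\<Sum>i\<in>UNIV. \<mu> $ i \<bullet> G i)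
    - K * (\<Sum>k\<in>UNIV. (\<Sum>i\<in>UNIV. \<Sum>j\<in>UNIV. a i j * \<bar>\<mu> $ i $ k - \<mu> $ j $ k\<bar>) / 2)"
proof -
  obtain \<sigma> where \<sigma>: "\<And>i j k. \<sigma> i j $ k \<in> sgn_set (\<mu> $ i $ k - \<mu> $ j $ k)"
      and odd: "\<And>i j. \<sigma> j i = - \<sigma> i j"
      and h_eq: "\<And>i. h $ i = G i - K *\<^sub>R (\<Sum>j\<in>UNIV. a i j *\<^sub>R \<sigma> i j)"
    using h unfolding multiplier_subgradients_def by blast
  define S where "S = (\<Sum>i\<in>UNIV. \<Sum>j\<in>UNIV. a i j * (\<mu> $ i \<bullet> \<sigma> i j))"
  have "S = (\<Sum>j\<in>UNIV. \<Sum>i\<in>UNIV. a i j * (\<mu> $ i \<bullet> \<sigma> i j))"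
    unfolding S_def by (rule sum.swap)
  also have "\<dots> = (\<Sum>i\<in>UNIV. \<Sum>j\<in>UNIV. - (a i j * (\<mu> $ j \<bullet> \<sigma> i j)))"
    by (intro sum.cong refl) (subst sym, subst odd, simp)
  finally have "2 * S = (\<Sum>i\<in>UNIV. \<Sum>j\<in>UNIV. a i j * ((\<mu> $ i - \<mu> $ j) \<bullet> \<sigma> i j))"
    by (simp add: S_def inner_diff_left right_diff_distrib sum_subtractf sum_negf)
  also have "\<dots> = (\<Sum>i\<in>UNIV. \<Sum>j\<in>UNIV. \<Sum>k\<in>UNIV. a i j * \<bar>\<mu> $ i $ k - \<mu> $ j $ k\<bar>)"
  proof (intro sum.cong refl)
    fix i j
    have "(\<mu> $ i $ k - \<mu> $ j $ k) * \<sigma> i j $ k = \<bar>\<mu> $ i $ k - \<mu> $ j $ k\<bar>" for k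
      using \<sigma>[of i j k] by (auto simp: sgn_set_def split: if_splits)
    then have "(\<mu> $ i - \<mu> $ j) \<bullet> \<sigma> i j = (\<Sum>k\<in>UNIV. \<bar>\<mu> $ i $ k - \<mu> $ j $ k\<bar>)"
      by (simp add: inner_vec_def)
    then show "a i j * ((\<mu> $ i - \<mu> $ j) \<bullet> \<sigma> i j) = (\<Sum>k\<in>UNIV. a i j * \<bar>\<mu> $ i $ k - \<mu> $ j $ k\<bar>)"
      by (simp add: sum_distrib_left)
  qed
  also have "\<dots> = (\<Sum>i\<in>UNIV. \<Sum>k\<in>UNIV. \<Sum>j\<in>UNIV. a i j * \<bar>\<mu> $ i $ k - \<mu> $ j $ k\<bar>)"
    by (intro sum.cong refl sum.swap)
  also have "\<dots> = (\<Sum>k\<in>UNIV. \<Sum>i\<in>UNIV. \<Sum>j\<in>UNIV. a i j * \<bar>\<mu> $ i $ k - \<mu> $ j $ k\<bar>)"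
    by (rule sum.swap)
  finally have S: "S = (\<Sum>k\<in>UNIV. (\<Sum>i\<in>UNIV. \<Sum>j\<in>UNIV. a i j * \<bar>\<mu> $ i $ k - \<mu> $ j $ k\<bar>) / 2)"
    by (simp flip: sum_divide_distrib)
  have "\<mu> \<bullet> h = (\<Sum>i\<in>UNIV. \<mu> $ i \<bullet> G i) - K * S"
    by (simp add: inner_vec_def[of \<mu> h] h_eq inner_diff_right inner_sum_right sum_subtractf
        sum_distrib_left S_def)
  then show ?thesis
    unfolding S .
qed

text \<open>In each component, split every multiplier into the value m of one arbitrary reference
  agent and a deviation. The common part is m >= 0 times the summed constraint, hence nonpositive.
  Each of the N deviations is at most the edge variation and is multiplied by a constraint value
  bounded by \<open>Kg\<close>, which is where the condition on K comes from.\<close>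

lemma multiplier_constraint_le_consensus_penalty:
  fixes \<mu> :: "real ^ 'q::finite ^ 'i::finite"
  assumes conn: "undirected_connected E"
    and \<mu>: "\<And>i. \<mu> $ i \<in> nonneg_orthant"
    and G: "\<And>i. norm (G i) \<le> Kg" "(\<Sum>i\<in>UNIV. G i) \<le> 0"
    and K: "K \<ge> real CARD('i) * Kg"
  shows "(\<Sum>i\<in>UNIV. \<mu> $ i \<bullet> G i) \<le> K * (\<Sum>k\<in>UNIV.
    (\<Sum>i\<in>UNIV. \<Sum>j\<in>UNIV. adjacency E i j * \<bar>\<mu> $ i $ k - \<mu> $ j $ k\<bar>) / 2)"
proof -
  define D where "D = (\<lambda>k. (\<Sum>i\<in>UNIV. \<Sum>j\<in>UNIV. adjacency E i j * \<bar>\<mu> $ i $ k - \<mu> $ j $ k\<bar>) / 2)"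
  have component: "(\<Sum>i\<in>UNIV. \<mu> $ i $ k * G i $ k) \<le> K * D k" for k
  proof -
    fix j :: 'i
    define m where "m = \<mu> $ j $ k"
    have dist: "\<bar>\<mu> $ i $ k - m\<bar> \<le> D k" for i
      unfolding D_def m_def by (rule oscillation_le_edge_variation[OF conn])
    have "m \<ge> 0"
      using \<mu>[of j] unfolding m_def nonneg_orthant_def less_eq_vec_def by simp
    have "(\<Sum>i\<in>UNIV. G i $ k) \<le> 0"
      using G(2) by (simp add: less_eq_vec_def)
    then have "m * (\<Sum>i\<in>UNIV. G i $ k) \<le> 0"
      using \<open>m \<ge> 0\<close> by (simp add: mult_nonneg_nonpos)
    moreover have "(\<mu> $ i $ k - m) * G i $ k \<le> Kg * D k" for i
    proof -
      have "(\<mu> $ i $ k - m) * G i $ k \<le> \<bar>\<mu> $ i $ k - m\<bar> * \<bar>G i $ k\<bar>"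
        by (metis abs_ge_self abs_mult)
      also have "\<dots> \<le> D k * Kg"
        using dist[of i] component_le_norm_cart[of "G i" k] G(1)[of i] by (intro mult_mono) auto
      finally show ?thesis
        by (simp add: mult.commute)
    qed
    then have "(\<Sum>i\<in>UNIV. (\<mu> $ i $ k - m) * G i $ k) \<le> (\<Sum>i\<in>(UNIV :: 'i set). Kg * D k)"
      by (intro sum_mono)
    moreover have "real CARD('i) * Kg * D k \<le> K * D k"
      using K dist[of j] by (intro mult_right_mono) auto
    moreover have "(\<Sum>i\<in>UNIV. \<mu> $ i $ k * G i $ k)
        = (\<Sum>i\<in>UNIV. (\<mu> $ i $ k - m) * G i $ k) + m * (\<Sum>i\<in>UNIV. G i $ k)"
      by (simp add: sum_distrib_left left_diff_distrib flip: sum.distrib)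
    ultimately show ?thesis
      by simp
  qed
  have "(\<Sum>i\<in>UNIV. \<mu> $ i \<bullet> G i) = (\<Sum>k\<in>UNIV. \<Sum>i\<in>UNIV. \<mu> $ i $ k * G i $ k)"
    unfolding inner_vec_def inner_real_def by (rule sum.swap)
  also have "\<dots> \<le> (\<Sum>k\<in>UNIV. K * D k)"
    by (intro sum_mono component)
  finally show ?thesis
    by (simp add: D_def sum_distrib_left)
qed

text \<open>Nonnegative multipliers preserve the direction of the componentwise subgradient
  inequalities, so H acts on S as a subgradient of the sum of f and the \<mu>-weighted
  constraints.\<close>

lemma lagrangian_subgradient_inequality:
  assumes H: "H \<in> lagrangian_subgradients_y V S f g y \<mu>" and \<mu>: "\<mu> \<in> nonneg_orthant" and z: "z \<in> S"
  shows "H \<bullet> (z - y) \<le> f z - f y + \<mu> \<bullet> (g z - g y)"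
proof -
  obtain a b where H_eq: "H = a + (\<Sum>k\<in>UNIV. (\<mu> $ k) *\<^sub>R b k)"
      and a: "a \<in> subdifferential V S f y"
      and b: "\<And>k. b k \<in> subdifferential V S (\<lambda>z. g z $ k) y"
    using H unfolding lagrangian_subgradients_y_def by blast
  have "a \<bullet> (z - y) \<le> f z - f y"
    using a z by (auto simp: subdifferential_def)
  moreover have "\<mu> $ k * (b k \<bullet> (z - y)) \<le> \<mu> $ k * (g z $ k - g y $ k)" for k
    using b[of k] z \<mu> by (intro mult_left_mono) (auto simp: subdifferential_def nonneg_orthant_def less_eq_vec_def)
  then have "(\<Sum>k\<in>UNIV. \<mu> $ k * (b k \<bullet> (z - y))) \<le> \<mu> \<bullet> (g z - g y)"
    by (auto simp: inner_vec_def intro!: sum_mono)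
  ultimately show ?thesis
    by (simp add: H_eq inner_add_left inner_sum_left)
qed

lemma block_identity_mult: "v \<in> coord_space I \<Longrightarrow> block_identity I *v v = v"
proof (unfold vec_eq_iff, intro allI)
  fix i
  assume "v \<in> coord_space I"
  then show "(block_identity I *v v) $ i = v $ i"
    by (cases "i \<in> I") (simp_all add: block_identity_def matrix_vector_mult_def coord_space_def
        if_distrib[of "\<lambda>c. c * _"] sum.delta cong: if_cong)
qed

lemma subspace_coord_space: "subspace (coord_space I)"
  by (auto simp: subspace_def coord_space_def)

lemma nonneg_orthant_closed_convex:
  "closed (nonneg_orthant :: (real ^ 'q::finite) set)" "convex (nonneg_orthant :: (real ^ 'q) set)"
proof -
  have eq: "(nonneg_orthant :: (real ^ 'q) set) = {v. \<forall>k. 0 \<le> v $ k}"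
    by (auto simp: nonneg_orthant_def less_eq_vec_def)
  show "closed (nonneg_orthant :: (real ^ 'q) set)"
    unfolding eq by (intro closed_Collect_all closed_Collect_le continuous_intros)
  show "convex (nonneg_orthant :: (real ^ 'q) set)"
    unfolding eq by (auto simp: convex_def)
qed

text \<open>Integrability is part of the conclusion because \<open>integral\<close> takes the value
  0 on a function without an integral, so that the bound alone would then hold trivially.\<close>

theorem theorem1:
  fixes E :: "'i::finite set set"
    and IX :: "'i \<Rightarrow> 'n::finite set"
    and IU :: "'i \<Rightarrow> 'm::finite set"
    and IY :: "'i \<Rightarrow> 'p::finite set"
    and A :: "'i \<Rightarrow> real ^ 'n ^ 'n"
    and B :: "'i \<Rightarrow> real ^ 'm ^ 'n"
    and C :: "'i \<Rightarrow> real ^ 'n ^ 'p"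
    and K\<^sub>\<alpha> :: "'i \<Rightarrow> real ^ 'n ^ 'm"
    and K\<^sub>\<beta> :: "'i \<Rightarrow> real ^ 'p ^ 'm"
    and Y :: "'i \<Rightarrow> (real ^ 'p) set"
    and f :: "'i \<Rightarrow> real \<Rightarrow> real ^ 'p \<Rightarrow> real"
    and g :: "'i \<Rightarrow> real \<Rightarrow> real ^ 'p \<Rightarrow> real ^ 'q::finite"
    and T \<epsilon> K\<^sub>f K\<^sub>g K\<^sub>\<mu> :: real
    and x :: "real \<Rightarrow> real ^ 'n ^ 'i"
    and u :: "real \<Rightarrow> real ^ 'm ^ 'i"
    and y :: "real \<Rightarrow> real ^ 'p ^ 'i"
    and \<mu> :: "real \<Rightarrow> real ^ 'q ^ 'i"
    and Hy :: "real \<Rightarrow> real ^ 'p ^ 'i"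
    and H\<mu> :: "real \<Rightarrow> real ^ 'q ^ 'i"
    and ystar :: "real ^ 'p ^ 'i"
  assumes dims: "\<And>i. A i \<in> block_matrices (IX i) (IX i)"
      "\<And>i. B i \<in> block_matrices (IX i) (IU i)"
      "\<And>i. C i \<in> block_matrices (IY i) (IX i)"
      "\<And>i. K\<^sub>\<alpha> i \<in> block_matrices (IU i) (IX i)"
      "\<And>i. K\<^sub>\<beta> i \<in> block_matrices (IU i) (IY i)"
      "\<And>i. Y i \<subseteq> coord_space (IY i)"
    and T: "T \<ge> 0" and eps: "\<epsilon> > 0"
    and A1: "undirected_connected E"
    and A2_sets: "\<And>i. convex (Y i)" "\<And>i. compact (Y i)"
    and A2_convex: "\<And>i t. t \<in> {0..T} \<Longrightarrow> convex_on (Y i) (f i t)"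
      "\<And>i k t. t \<in> {0..T} \<Longrightarrow> convex_on (Y i) (\<lambda>z. g i t z $ k)"
    and A2_integrable: "\<And>i z. z \<in> Y i \<Longrightarrow> (\<lambda>t. f i t z) absolutely_integrable_on {0..T}"
      "\<And>i k z. z \<in> Y i \<Longrightarrow> (\<lambda>t. g i t z $ k) absolutely_integrable_on {0..T}"
    and A2_bounded: "K\<^sub>f > 0" "K\<^sub>g > 0"
      "\<And>i t z. t \<in> {0..T} \<Longrightarrow> z \<in> Y i \<Longrightarrow> \<bar>f i t z\<bar> \<le> K\<^sub>f"
      "\<And>i t z. t \<in> {0..T} \<Longrightarrow> z \<in> Y i \<Longrightarrow> norm (g i t z) \<le> K\<^sub>g"
    and A3: "feasible_set T Y g \<noteq> {}"
    and A4: "\<And>i. controllable (IX i) (IU i) (A i) (B i)"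
      "\<And>i. rank (C i ** B i) = card (IY i)"
    and gains: "\<And>i. C i ** B i ** K\<^sub>\<alpha> i = C i ** A i"
      "\<And>i. C i ** B i ** K\<^sub>\<beta> i = block_identity (IY i)"
    and ystar: "optimal_solution T Y f g ystar"
    and K\<^sub>\<mu>: "K\<^sub>\<mu> \<ge> real CARD('i) * K\<^sub>g"
    and abs_cont: "abs_continuous_on 0 T x" "abs_continuous_on 0 T \<mu>"
    and in_sets: "\<And>i t. t \<in> {0..T} \<Longrightarrow> x t $ i \<in> coord_space (IX i)"
      "\<And>i t. t \<in> {0..T} \<Longrightarrow> y t $ i \<in> Y i"
      "\<And>i t. t \<in> {0..T} \<Longrightarrow> \<mu> t $ i \<in> nonneg_orthant"
    and initial: "\<mu> 0 = 0"
    and dynamics: "\<And>i. AE t in lebesgue_on {0..T}.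
        ((\<lambda>s. x s $ i) has_vector_derivative A i *v x t $ i + B i *v u t $ i) (at t within {0..T})"
    and outputs: "\<And>i t. t \<in> {0..T} \<Longrightarrow> y t $ i = C i *v x t $ i"
    and Hy: "\<And>i. AE t in lebesgue_on {0..T}.
        Hy t $ i \<in> lagrangian_subgradients_y (coord_space (IY i)) (Y i) (f i t) (g i t)
          (y t $ i) (\<mu> t $ i)"
    and H\<mu>: "AE t in lebesgue_on {0..T}.
        H\<mu> t \<in> multiplier_subgradients (adjacency E) K\<^sub>\<mu> (\<lambda>i. g i t (y t $ i)) (\<mu> t)"
    and controller: "\<And>i. AE t in lebesgue_on {0..T}.
        u t $ i = - (K\<^sub>\<alpha> i *v x t $ i)
          + K\<^sub>\<beta> i *v proj_direction (Y i) (y t $ i) (- \<epsilon> *\<^sub>R Hy t $ i)"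
    and multiplier: "\<And>i. AE t in lebesgue_on {0..T}.
        ((\<lambda>s. \<mu> s $ i) has_vector_derivative
          proj_direction nonneg_orthant (\<mu> t $ i) (\<epsilon> *\<^sub>R H\<mu> t $ i)) (at t within {0..T})"
  shows "(\<lambda>t. total_cost f t (y t) - total_cost f t ystar) absolutely_integrable_on {0..T} \<and>
    integral {0..T} (\<lambda>t. total_cost f t (y t) - total_cost f t ystar)
      \<le> (norm (y 0 - ystar))\<^sup>2 / (2 * \<epsilon>)"
proof -
  let ?P = "\<lambda>t i. proj_direction (Y i) (y t $ i) (- \<epsilon> *\<^sub>R Hy t $ i)"
  let ?Q = "\<lambda>t i. proj_direction nonneg_orthant (\<mu> t $ i) (\<epsilon> *\<^sub>R H\<mu> t $ i)"
  let ?deriv = "\<lambda>X D t. (X has_vector_derivative D) (at t within {0..T})"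
  have feasible: "ystar \<in> feasible_set T Y g"
    using ystar by (simp add: optimal_solution_def is_arg_min_def)
  then have ystar_in: "ystar $ i \<in> Y i" for i
    by (simp add: feasible_set_def)
  have closed_Y: "closed (Y i)" for i
    using A2_sets(2) by (rule compact_imp_closed)

  \<comment> \<open>The agents are finitely many, so a single negligible set serves for all the
    closed-loop relations.\<close>
  have "AE t in lebesgue_on {0..T}.
      (\<forall>i. ?deriv (\<lambda>s. x s $ i) (A i *v x t $ i + B i *v u t $ i) t) \<and>
      (\<forall>i. Hy t $ i \<in> lagrangian_subgradients_y (coord_space (IY i)) (Y i) (f i t) (g i t)
          (y t $ i) (\<mu> t $ i)) \<and>
      (\<forall>i. u t $ i = - (K\<^sub>\<alpha> i *v x t $ i) + K\<^sub>\<beta> i *v ?P t i) \<and>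
      (\<forall>i. ?deriv (\<lambda>s. \<mu> s $ i) (?Q t i) t) \<and>
      H\<mu> t \<in> multiplier_subgradients (adjacency E) K\<^sub>\<mu> (\<lambda>i. g i t (y t $ i)) (\<mu> t)"
    by (intro AE_conjI AE_all_countable[THEN iffD2] allI dynamics Hy controller multiplier H\<mu>)
  then obtain N where N: "negligible N" and good: "\<And>t. t \<in> {0..T} - N \<Longrightarrow>
      (\<forall>i. ?deriv (\<lambda>s. x s $ i) (A i *v x t $ i + B i *v u t $ i) t) \<and>
      (\<forall>i. Hy t $ i \<in> lagrangian_subgradients_y (coord_space (IY i)) (Y i) (f i t) (g i t)
          (y t $ i) (\<mu> t $ i)) \<and>
      (\<forall>i. u t $ i = - (K\<^sub>\<alpha> i *v x t $ i) + K\<^sub>\<beta> i *v ?P t i) \<and>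
      (\<forall>i. ?deriv (\<lambda>s. \<mu> s $ i) (?Q t i) t) \<and>
      H\<mu> t \<in> multiplier_subgradients (adjacency E) K\<^sub>\<mu> (\<lambda>i. g i t (y t $ i)) (\<mu> t)"
    by (rule AE_lebesgue_on_negligibleE) auto
  have x_deriv: "?deriv (\<lambda>s. x s $ i) (A i *v x t $ i + B i *v u t $ i) t"
    and Hy_in: "Hy t $ i \<in> lagrangian_subgradients_y (coord_space (IY i)) (Y i) (f i t) (g i t)
      (y t $ i) (\<mu> t $ i)"
    and u_eq: "u t $ i = - (K\<^sub>\<alpha> i *v x t $ i) + K\<^sub>\<beta> i *v ?P t i"
    and \<mu>_deriv: "?deriv (\<lambda>s. \<mu> s $ i) (?Q t i) t"
    and H\<mu>_in: "H\<mu> t \<in> multiplier_subgradients (adjacency E) K\<^sub>\<mu> (\<lambda>i. g i t (y t $ i)) (\<mu> t)"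
    if "t \<in> {0..T} - N" for t i
    using good[OF that] by blast+

  \<comment> \<open>Stacking the output matrices exhibits y as a bounded linear image of x on [0,T],
    from which it inherits absolute continuity.\<close>
  define \<Phi> where "\<Phi> = (\<lambda>v :: real ^ 'n ^ 'i. \<chi> i. C i *v v $ i)"
  have "linear \<Phi>"
    by (rule linearI) (simp_all add: \<Phi>_def vec_eq_iff matrix_vector_right_distrib matrix_vector_mult_scaleR)
  then have bl: "bounded_linear \<Phi>"
    by (simp add: linear_conv_bounded_linear)
  then obtain L where L: "\<And>v. norm (\<Phi> v) \<le> norm v * L"
    using bounded_linear.bounded by blast
  have y_eq: "y t = \<Phi> (x t)" if "t \<in> {0..T}" for t
    using outputs[OF that] by (simp add: \<Phi>_def vec_eq_iff)
  have "continuous_on {0..T} (\<lambda>t. \<Phi> (x t))"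
    by (rule bounded_linear.continuous_on[OF bl abs_continuous_on_imp_continuous_on[OF abs_cont(1)]])
  then have "continuous_on {0..T} y"
    by (rule continuous_on_eq) (simp add: y_eq)
  then have y_cont: "continuous_on {0..T} (\<lambda>t. y t $ i)" for i
    by (intro continuous_intros)
  have "abs_continuous_on 0 T (\<lambda>t. y t - ystar)"
  proof (rule abs_continuous_on_dominated[OF abs_cont(1)])
    fix r s assume "r \<in> {0..T}" "s \<in> {0..T}"
    then have "y s - ystar - (y r - ystar) = \<Phi> (x s - x r)"
      by (simp add: y_eq linear_diff[OF \<open>linear \<Phi>\<close>])
    then show "norm (y s - ystar - (y r - ystar)) \<le> L * norm (x s - x r)"
      using L[of "x s - x r"] by (simp add: mult.commute)
  qed
  then have ac: "abs_continuous_on 0 T (\<lambda>t. (norm (y t - ystar))\<^sup>2 + (norm (\<mu> t))\<^sup>2)"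
    by (intro abs_continuous_on_add abs_continuous_on_norm_square abs_cont(2))

  have y_deriv: "?deriv (\<lambda>s. y s $ i) (?P t i) t" if t: "t \<in> {0..T} - N" for t i
  proof -
    have "?deriv (\<lambda>s. C i *v x s $ i) (C i *v (A i *v x t $ i + B i *v u t $ i)) t"
      by (intro bounded_linear.has_vector_derivative[OF matrix_vector_mul_bounded_linear] x_deriv t)
    \<comment> \<open>The first gain equation makes the state feedback cancel the drift; the second
      passes the projected direction through unchanged, since that direction lies in the agent's
      output subspace.\<close>
    also have "C i *v (A i *v x t $ i + B i *v u t $ i) = (C i ** A i) *v x t $ i + (C i ** B i) *v u t $ i"
      by (simp only: matrix_vector_right_distrib matrix_vector_mul_assoc)
    also have "u t $ i = - (K\<^sub>\<alpha> i *v x t $ i) + K\<^sub>\<beta> i *v ?P t i"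
      by (rule u_eq[OF t])
    also have "(C i ** B i) *v (- (K\<^sub>\<alpha> i *v x t $ i) + K\<^sub>\<beta> i *v ?P t i)
        = - ((C i ** B i ** K\<^sub>\<alpha> i) *v x t $ i) + (C i ** B i ** K\<^sub>\<beta> i) *v ?P t i"
      using linear_neg[OF matrix_vector_mul_linear, of "C i ** B i" "K\<^sub>\<alpha> i *v x t $ i"]
      by (simp only: matrix_vector_right_distrib matrix_vector_mul_assoc)
    also have "(C i ** B i ** K\<^sub>\<beta> i) *v ?P t i = ?P t i"
      unfolding gains
      using proj_direction_in_subspace[OF closed_Y A2_sets(1) in_sets(2) subspace_coord_space dims(6)] t
      by (intro block_identity_mult) auto
    finally have "?deriv (\<lambda>s. C i *v x s $ i) (?P t i) t"
      unfolding gains by simp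
    then show ?thesis
      by (rule has_vector_derivative_transform[rotated 2]) (use t outputs in auto)
  qed

  have integrable_along: "(\<lambda>t. f i t (y t $ i)) absolutely_integrable_on {0..T}" for i
  proof (rule convex_along_trajectory_absolutely_integrable[where S = "Y i" and K = K\<^sub>f, OF _ _ _ _ _ N])
    \<comment> \<open>Membership of \<open>Hy t $ i\<close> in the Lagrangian subgradients supplies,
      as its first summand, a subgradient of the cost itself.\<close>
    fix t assume "t \<in> {0..T} - N"
    then show "subdifferential (coord_space (IY i)) (Y i) (f i t) (y t $ i) \<noteq> {}"
      using Hy_in[of t i] unfolding lagrangian_subgradients_y_def by blast
  qed (use A2_convex A2_bounded A2_integrable y_cont in_sets in auto)
  define R where "R = (\<lambda>t. total_cost f t (y t) - total_cost f t ystar)"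
  have R_int: "R absolutely_integrable_on {0..T}"
    unfolding R_def total_cost_def
    by (intro set_integral_diff absolutely_integrable_sum integrable_along A2_integrable ystar_in) auto

  define G where "G = (\<lambda>t. (norm (y t - ystar))\<^sup>2 + (norm (\<mu> t))\<^sup>2)"
  define G' where "G' = (\<lambda>t. 2 * (\<Sum>i\<in>UNIV. ?P t i \<bullet> (y t $ i - ystar $ i)) + 2 * (\<Sum>i\<in>UNIV. ?Q t i \<bullet> \<mu> t $ i))"
  have "G T - G 0 \<le> integral {0..T} (\<lambda>t. - (2 * \<epsilon>) * R t)"
  proof (rule abs_continuous_on_le_integral[OF T _ _ N])
    show "abs_continuous_on 0 T G"
      unfolding G_def by (rule ac)
    show "(\<lambda>t. - (2 * \<epsilon>) * R t) integrable_on {0..T}"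
      using integrable_cmul[OF set_lebesgue_integral_eq_integral(1)[OF R_int], of "- (2 * \<epsilon>)"]
      by (simp only: real_scaleR_def)
    fix t assume t: "t \<in> {0..T} - N"
    \<comment> \<open>Stated for a general centre c so that it covers both halves of the energy: the
      outputs with \<open>ystar\<close> and the multipliers with 0.\<close>
    have sq: "?deriv (\<lambda>s. (X s $ i - c $ i) \<bullet> (X s $ i - c $ i)) (2 * (D \<bullet> (X t $ i - c $ i))) t"
      if "?deriv (\<lambda>s. X s $ i) D t" for X :: "real \<Rightarrow> real ^ 'k ^ 'i" and c D i
    proof -
      have "?deriv (\<lambda>s. X s $ i - c $ i) D t"
        using that by (auto intro!: derivative_eq_intros)
      from bounded_bilinear.has_vector_derivative[OF bounded_bilinear_inner this this]
      show ?thesis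
        by (simp add: inner_commute)
    qed
    have "?deriv (\<lambda>s. (\<Sum>i\<in>UNIV. (y s $ i - ystar $ i) \<bullet> (y s $ i - ystar $ i))
          + (\<Sum>i\<in>UNIV. (\<mu> s $ i - 0 $ i) \<bullet> (\<mu> s $ i - 0 $ i)))
        ((\<Sum>i\<in>UNIV. 2 * (?P t i \<bullet> (y t $ i - ystar $ i))) + (\<Sum>i\<in>UNIV. 2 * (?Q t i \<bullet> (\<mu> t $ i - 0 $ i)))) t"
      by (intro has_vector_derivative_add has_vector_derivative_sum sq y_deriv[OF t] \<mu>_deriv[OF t])
    then show "?deriv G (G' t) t"
      by (simp add: G_def G'_def power2_norm_eq_inner inner_vec_def sum_distrib_left)

    have y_bound: "(\<Sum>i\<in>UNIV. ?P t i \<bullet> (y t $ i - ystar $ i))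
        \<le> (\<Sum>i\<in>UNIV. \<epsilon> * (f i t (ystar $ i) - f i t (y t $ i)
            + (\<mu> t $ i \<bullet> g i t (ystar $ i) - \<mu> t $ i \<bullet> g i t (y t $ i))))"
    proof (rule sum_mono)
      fix i
      have "?P t i \<bullet> (y t $ i - ystar $ i) \<le> (- \<epsilon> *\<^sub>R Hy t $ i) \<bullet> (y t $ i - ystar $ i)"
        using t by (intro proj_direction_normal closed_Y A2_sets in_sets ystar_in) auto
      also have "\<dots> = \<epsilon> * (Hy t $ i \<bullet> (ystar $ i - y t $ i))"
        by (simp add: inner_diff_right algebra_simps)
      also have "\<dots> \<le> \<epsilon> * (f i t (ystar $ i) - f i t (y t $ i)
          + \<mu> t $ i \<bullet> (g i t (ystar $ i) - g i t (y t $ i)))"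
        using t eps
        by (intro mult_left_mono lagrangian_subgradient_inequality[OF Hy_in[OF t] in_sets(3) ystar_in]) auto
      finally show "?P t i \<bullet> (y t $ i - ystar $ i) \<le> \<epsilon> * (f i t (ystar $ i) - f i t (y t $ i)
          + (\<mu> t $ i \<bullet> g i t (ystar $ i) - \<mu> t $ i \<bullet> g i t (y t $ i)))"
        by (simp add: inner_diff_right)
    qed
    define D where "D = K\<^sub>\<mu> * (\<Sum>k\<in>UNIV.
      (\<Sum>i\<in>UNIV. \<Sum>j\<in>UNIV. adjacency E i j * \<bar>\<mu> t $ i $ k - \<mu> t $ j $ k\<bar>) / 2)"
    have "(\<Sum>i\<in>UNIV. ?Q t i \<bullet> \<mu> t $ i) \<le> (\<Sum>i\<in>UNIV. \<epsilon> * (\<mu> t $ i \<bullet> H\<mu> t $ i))"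
    proof (rule sum_mono)
      fix i
      \<comment> \<open>The comparison point is the origin of the orthant, matching the uncentred
        term in the energy.\<close>
      have "?Q t i \<bullet> (\<mu> t $ i - 0) \<le> (\<epsilon> *\<^sub>R H\<mu> t $ i) \<bullet> (\<mu> t $ i - 0)"
        using t by (intro proj_direction_normal nonneg_orthant_closed_convex in_sets)
          (auto simp: nonneg_orthant_def)
      then show "?Q t i \<bullet> \<mu> t $ i \<le> \<epsilon> * (\<mu> t $ i \<bullet> H\<mu> t $ i)"
        by (simp add: inner_commute)
    qed
    also have "\<dots> = \<epsilon> * (\<mu> t \<bullet> H\<mu> t)"
      by (simp add: inner_vec_def[of "\<mu> t"] sum_distrib_left)
    also have "\<mu> t \<bullet> H\<mu> t = (\<Sum>i\<in>UNIV. \<mu> t $ i \<bullet> g i t (y t $ i)) - D"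
      unfolding D_def
      by (intro inner_multiplier_subgradient H\<mu>_in t) (simp add: adjacency_def insert_commute)
    finally have \<mu>_bound: "(\<Sum>i\<in>UNIV. ?Q t i \<bullet> \<mu> t $ i)
      \<le> \<epsilon> * ((\<Sum>i\<in>UNIV. \<mu> t $ i \<bullet> g i t (y t $ i)) - D)" .
    have "(\<Sum>i\<in>UNIV. \<mu> t $ i \<bullet> g i t (ystar $ i)) \<le> D"
      unfolding D_def
    proof (rule multiplier_constraint_le_consensus_penalty[OF A1 _ _ _ K\<^sub>\<mu>])
      show "(\<Sum>i\<in>UNIV. g i t (ystar $ i)) \<le> 0"
        using feasible t by (simp add: feasible_set_def)
    qed (use t in_sets A2_bounded ystar_in in auto)
    then have "\<epsilon> * ((\<Sum>i\<in>UNIV. \<mu> t $ i \<bullet> g i t (ystar $ i)) - D) \<le> 0"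
      using eps by (simp add: mult_nonneg_nonpos)
    \<comment> \<open>Adding the two bounds cancels the terms pairing \<mu> with the constraints at
      y. What remains beside the regret is the pairing with the constraints at \<open>ystar\<close>
      minus D, which is nonpositive.\<close>
    then show "G' t \<le> - (2 * \<epsilon>) * R t"
      using y_bound \<mu>_bound
      by (simp add: G'_def R_def total_cost_def sum.distrib sum_subtractf algebra_simps
          flip: sum_distrib_left)
  qed
  then have "2 * \<epsilon> * integral {0..T} R \<le> G 0 - G T"
    by simp
  \<comment> \<open>The energy at time T is nonnegative and is dropped; at time 0 the multipliers
    vanish, so only the output error is left.\<close>
  also have "\<dots> \<le> (norm (y 0 - ystar))\<^sup>2"
    by (simp add: G_def initial)
  finally have "integral {0..T} R \<le> (norm (y 0 - ystar))\<^sup>2 / (2 * \<epsilon>)"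
    using eps by (simp add: pos_le_divide_eq mult.commute)
  then show ?thesis
    using R_int unfolding R_def by blast
qed

end
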